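(* Let $n\geq1$ and let $u,v\in\mathcal{C}_n^{*}$ be the readings of two admissible columns $U$ and $V$ respectively, such that $U\not\succeq V$. Suppose that the symplectic tableau $P(uv)$ has two columns and let $W$ be its rightmost column. Then $U$ contains (strictly) more elements than $W$, i.e. $h(U)>h(W)$.
   Context: **Words and crystal operators.** Let $\mathcal{C}_n=\{1<2<\dots<n<\overline{n}<\dots<\overline{2}<\overline{1}\}$, a totally ordered alphabet, and $\mathcal{C}_n^{*}$ the free monoid on it. The letters $1,\dots,n$ are called unbarred. For $i\in\{1,\dots,n\}$ and a word $w$, the operators $\widetilde e_i,\widetilde f_i:\mathcal{C}_n^{*}\to\mathcal{C}_n^{*}\cup\{0\}$ are defined as follows. Keep only the letters $i,i+1,\overline{i+1},\overline{i}$ of $w$ (only $n,\overline n$ if $i=n$); mark $i$ and $\overline{i+1}$ by $+$, and $i+1$ and $\overline{i}$ by $-$ (for $i=n$: $n$ by $+$, $\overline n$ by $-$). Repeatedly delete adjacent pairs marked $+-$ (in this order) until none is left; the remaining letters are marked $-^r+^s$. If $r>0$, $\widetilde e_i(w)$ is obtained from $w$ by changing the letter of the rightmost remaining $-$ ($i+1\mapsto i$, $\overline i\mapsto\overline{i+1}$, and for $i=n$: $\overline n\mapsto n$); if $r=0$, $\widetilde e_i(w)=0$. If $s>0$, $\widetilde f_i(w)$ is obtained from $w$ by changing the letter of the leftmost remaining $+$ ($i\mapsto i+1$, $\overline{i+1}\mapsto\overline i$, and for $i=n$: $n\mapsto\overline n$); if $s=0$, $\widetilde f_i(w)=0$. The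 crystal graph $G_n$ has vertex set $\mathcal{C}_n^{*}$ and an arrow $a\xrightarrow{i}b$ whenever $\widetilde f_i(a)=b$. Let $B(w)$ be the connected component of $w$; it contains a unique vertex $w^0$ with $\widetilde e_i(w^0)=0$ for all $i$. The weight of a word is determined by $(d_1,\dots,d_n)$, where $d_i$ is its number of letters $i$ minus its number of letters $\overline i$. For words $u,v$, $u\sim v$ means that $B(u)$ and $B(v)$ are isomorphic by a weight-preserving isomorphism of labelled directed graphs and that $u$ and $v$ correspond under it, i.e. $u^0$ and $v^0$ have the same weight and there are $i_1,\dots,i_r$ with $u=\widetilde f_{i_1}\cdots\widetilde f_{i_r}(u^0)$ and $v=\widetilde f_{i_1}\cdots\widetilde f_{i_r}(v^0)$. **Admissible columns.** A column $U$ is a one-column Young diagram filled with letters of $\mathcal{C}_n$ strictly increasing from top to bottom; its reading $\mathrm{w}(U)$ is the word read from top to bottom, and $h(U)$ is its number of letters. $U$ is admissible if for every $m\in\{1,\dots,n\}$ the number $N(m)$ of letters $x$ of $U$ with $x\leq m$ or $x\geq\overline m$ satisfies $N(m)\leq m$. For an admissible column $U$ let $I=\{x_1>\dots>x_r\}$ be the set of unbarred $x$ with $x,\overline x\in U$. There is then (known fact) a set $J=\{y_1>\dots>y_r\}$ of unbarred letters such that $y_1$ is the greatest letter with $y_1<x_1$, $y_1,\overline{y_1}\notin U$, and for $i\geq2$, $y_i$ is the greatest letter with $y_i<\min(y_{i-1},x_i)$, $y_i,\overline{y_i}\notin U$. The column $rU$ is obtained from $U$ by replacing each $\overline{x_i}$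 by $\overline{y_i}$ and reordering; $lU$ is obtained by replacing each $x_i$ by $y_i$ and reordering. **Symplectic tableaux.** For columns $U_1,U_2$, write $U_1\leq U_2$ if $h(U_1)\geq h(U_2)$ and, placing $U_1$ to the left of $U_2$ with tops aligned, rows are weakly increasing from left to right. For admissible columns, $U_1\preceq U_2$ means $rU_1\leq lU_2$; $U\succeq V$ means $V\preceq U$, and $U\not\succeq V$ is its negation. A symplectic tableau is $T=U_1\dots U_r$ (nonempty columns listed from left to right) with all $U_i$ admissible and $U_i\preceq U_{i+1}$ for all $i$; its reading is $\mathrm{w}(T)=\mathrm{w}(U_r)\mathrm{w}(U_{r-1})\cdots\mathrm{w}(U_1)$. It is known (Lecouvey) that for every word $w$ there is a unique symplectic tableau $P(w)$ with $w\sim\mathrm{w}(P(w))$ (possibly the empty tableau, with zero columns). *)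

theory Defs
  imports Main
begin

section \<open>Letters and words\<close>

text \<open>The order on letters does not depend on the rank: the alphabet of rank \<open>n\<close> consists of
  the letters with index in \<open>{1..n}\<close>, on which the order is
  \<open>1 < 2 < ... < n < bar n < ... < bar 2 < bar 1\<close>.\<close>

datatype letter = Unb nat | Bar nat

instantiation letter :: linorder
begin

fun less_letter :: "letter \<Rightarrow> letter \<Rightarrow> bool" where
  "less_letter (Unb i) (Unb j) \<longleftrightarrow> i < j"
| "less_letter (Unb i) (Bar j) \<longleftrightarrow> True"
| "less_letter (Bar i) (Unb j) \<longleftrightarrow> False"
| "less_letter (Bar i) (Bar j) \<longleftrightarrow> j < i"

definition less_eq_letter :: "letter \<Rightarrow> letter \<Rightarrow> bool" where
  "less_eq_letter x y \<longleftrightarrow> x < y \<or> x = y"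

instance
proof
  fix x y z :: letter
  show "x < y \<longleftrightarrow> x \<le> y \<and> \<not> y \<le> x"
    by (cases x; cases y) (auto simp: less_eq_letter_def)
  show "x \<le> x" by (simp add: less_eq_letter_def)
  show "x \<le> y \<Longrightarrow> y \<le> z \<Longrightarrow> x \<le> z"
    by (cases x; cases y; cases z) (auto simp: less_eq_letter_def)
  show "x \<le> y \<Longrightarrow> y \<le> x \<Longrightarrow> x = y"
    by (cases x; cases y) (auto simp: less_eq_letter_def)
  show "x \<le> y \<or> y \<le> x"
    by (cases x; cases y) (auto simp: less_eq_letter_def)
qed

end

definition alphabet :: "nat \<Rightarrow> letter set" where
  "alphabet n = Unb ` {1..n} \<union> Bar ` {1..n}"

type_synonym word = "letter list"

definition words :: "nat \<Rightarrow> word set" where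
  "words n = lists (alphabet n)"

definition wt :: "word \<Rightarrow> nat \<Rightarrow> int" where
  "wt w i = int (count_list w (Unb i)) - int (count_list w (Bar i))"

section \<open>Crystal operators\<close>

definition is_plus :: "nat \<Rightarrow> nat \<Rightarrow> letter \<Rightarrow> bool" where
  "is_plus n i x \<longleftrightarrow> x = Unb i \<or> (i < n \<and> x = Bar (Suc i))"

definition is_minus :: "nat \<Rightarrow> nat \<Rightarrow> letter \<Rightarrow> bool" where
  "is_minus n i x \<longleftrightarrow> x = Bar i \<or> (i < n \<and> x = Unb (Suc i))"

text \<open>\<open>cancel p m xs\<close> deletes adjacent pairs consisting of a \<open>p\<close>-element followed by an
  \<open>m\<close>-element until none is left. The lemmas \<open>cancel_reachable\<close> and \<open>cancel_normal_form\<close> below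
  confirm this.\<close>

fun cancel :: "('a \<Rightarrow> bool) \<Rightarrow> ('a \<Rightarrow> bool) \<Rightarrow> 'a list \<Rightarrow> 'a list" where
  "cancel p m [] = []"
| "cancel p m (x # xs) =
     (case cancel p m xs of
        [] \<Rightarrow> [x]
      | y # ys \<Rightarrow> if p x \<and> m y then ys else x # y # ys)"

inductive del_pair :: "('a \<Rightarrow> bool) \<Rightarrow> ('a \<Rightarrow> bool) \<Rightarrow> 'a list \<Rightarrow> 'a list \<Rightarrow> bool" for p m where
  "p x \<Longrightarrow> m y \<Longrightarrow> del_pair p m (xs @ x # y # ys) (xs @ ys)"

lemma del_pair_Cons: "del_pair p m xs ys \<Longrightarrow> del_pair p m (z # xs) (z # ys)"
  by (induction rule: del_pair.induct) (metis append_Cons del_pair.intros)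

lemma cancel_reachable: "(del_pair p m)\<^sup>*\<^sup>* xs (cancel p m xs)"
proof (induction xs)
  case (Cons x xs)
  have step: "(del_pair p m)\<^sup>*\<^sup>* (x # xs) (x # cancel p m xs)"
    using Cons by (induction rule: rtranclp_induct) (auto intro: del_pair_Cons rtranclp.rtrancl_into_rtrancl)
  show ?case
  proof (cases "cancel p m xs")
    case (Cons y ys)
    have "p x \<Longrightarrow> m y \<Longrightarrow> del_pair p m (x # y # ys) ys"
      using del_pair.intros[of p x m y "[]" ys] by simp
    then show ?thesis
      using Cons step by (auto intro: rtranclp.rtrancl_into_rtrancl)
  qed (use step in simp)
qed simp

lemma cancel_successively: "successively (\<lambda>x y. \<not> (p x \<and> m y)) (cancel p m xs)"
  by (induction xs) (auto split: list.splits simp: successively_Cons)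

lemma cancel_normal_form: "\<not> del_pair p m (cancel p m xs) ys"
  using cancel_successively[of p m xs]
  by (auto elim!: del_pair.cases simp: successively_append_iff)

text \<open>Positions (counted from \<open>0\<close>) of the letters of \<open>w\<close> that are still marked after all
  cancellations.\<close>

definition unmatched :: "nat \<Rightarrow> nat \<Rightarrow> word \<Rightarrow> nat list" where
  "unmatched n i w =
     cancel (\<lambda>k. is_plus n i (w ! k)) (\<lambda>k. is_minus n i (w ! k))
       (filter (\<lambda>k. is_plus n i (w ! k) \<or> is_minus n i (w ! k)) [0..<length w])"

fun f_letter :: "nat \<Rightarrow> nat \<Rightarrow> letter \<Rightarrow> letter" where
  "f_letter n i (Unb j) = (if i < n then Unb (Suc i) else Bar i)"
| "f_letter n i (Bar j) = Bar i"

fun e_letter :: "nat \<Rightarrow> nat \<Rightarrow> letter \<Rightarrow> letter" where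
  "e_letter n i (Unb j) = Unb i"
| "e_letter n i (Bar j) = (if i < n then Bar (Suc i) else Unb i)"

text \<open>The value \<open>0\<close> of the crystal operators is \<open>None\<close>.\<close>

definition f_op :: "nat \<Rightarrow> nat \<Rightarrow> word \<Rightarrow> word option" where
  "f_op n i w =
     (case filter (\<lambda>k. is_plus n i (w ! k)) (unmatched n i w) of
        [] \<Rightarrow> None
      | k # _ \<Rightarrow> Some (w[k := f_letter n i (w ! k)]))"

definition e_op :: "nat \<Rightarrow> nat \<Rightarrow> word \<Rightarrow> word option" where
  "e_op n i w =
     (let ks = filter (\<lambda>k. is_minus n i (w ! k)) (unmatched n i w)
      in if ks = [] then None else Some (w[last ks := e_letter n i (w ! last ks)]))"

section \<open>Crystal graph and crystal equivalence\<close>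

definition arrow :: "nat \<Rightarrow> nat \<Rightarrow> word \<Rightarrow> word \<Rightarrow> bool" where
  "arrow n i a b \<longleftrightarrow> i \<in> {1..n} \<and> a \<in> words n \<and> b \<in> words n \<and> f_op n i a = Some b"

definition component :: "nat \<Rightarrow> word \<Rightarrow> word set" where
  "component n w = {a. equivclp (\<lambda>a b. \<exists>i. arrow n i a b) w a}"

definition crystal_iso :: "nat \<Rightarrow> word set \<Rightarrow> word set \<Rightarrow> (word \<Rightarrow> word) \<Rightarrow> bool" where
  "crystal_iso n A B \<phi> \<longleftrightarrow>
     bij_betw \<phi> A B \<and>
     (\<forall>a\<in>A. wt (\<phi> a) = wt a) \<and>
     (\<forall>a\<in>A. \<forall>b\<in>A. \<forall>i. arrow n i a b \<longleftrightarrow> arrow n i (\<phi> a) (\<phi> b))"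

definition crystal_equiv :: "nat \<Rightarrow> word \<Rightarrow> word \<Rightarrow> bool" where
  "crystal_equiv n u v \<longleftrightarrow>
     u \<in> words n \<and> v \<in> words n \<and>
     (\<exists>\<phi>. crystal_iso n (component n u) (component n v) \<phi> \<and> \<phi> u = v)"

section \<open>Admissible columns\<close>

text \<open>A column is given by its list of entries from top to bottom, so that its reading is the
  column itself and its height is its length.\<close>

type_synonym column = "letter list"

definition is_column :: "nat \<Rightarrow> column \<Rightarrow> bool" where
  "is_column n U \<longleftrightarrow> set U \<subseteq> alphabet n \<and> sorted_wrt (<) U"

definition admissible :: "nat \<Rightarrow> column \<Rightarrow> bool" where
  "admissible n U \<longleftrightarrow> is_column n U \<and>
     (\<forall>m\<in>{1..n}. card {x \<in> set U. x \<le> Unb m \<or> Bar m \<le> x} \<le> m)"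

text \<open>\<open>doubled U\<close> lists \<open>x\<^sub>1 > ... > x\<^sub>r\<close> and \<open>split_targets U\<close> lists
  \<open>y\<^sub>1 > ... > y\<^sub>r\<close>. In \<open>split_from U b xs\<close> the bound \<open>b\<close> is the previously chosen \<open>y\<close>; for the
  first element, the bound \<open>x\<^sub>1\<close> is vacuous. The maxima are over finite sets, which are
  nonempty when \<open>U\<close> is admissible.\<close>

definition doubled :: "column \<Rightarrow> nat list" where
  "doubled U = rev (sorted_list_of_set {x. Unb x \<in> set U \<and> Bar x \<in> set U})"

fun split_from :: "column \<Rightarrow> nat \<Rightarrow> nat list \<Rightarrow> nat list" where
  "split_from U b [] = []"
| "split_from U b (x # xs) =
     (let y = Max {y. 1 \<le> y \<and> y < min b x \<and> Unb y \<notin> set U \<and> Bar y \<notin> set U}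
      in y # split_from U y xs)"

definition split_targets :: "column \<Rightarrow> nat list" where
  "split_targets U = split_from U (hd (doubled U)) (doubled U)"

definition split_map :: "column \<Rightarrow> nat \<Rightarrow> nat" where
  "split_map U x =
     (case map_of (zip (doubled U) (split_targets U)) x of None \<Rightarrow> x | Some y \<Rightarrow> y)"

definition right_col :: "column \<Rightarrow> column" where
  "right_col U = sort (map (\<lambda>c. case c of Unb x \<Rightarrow> Unb x | Bar x \<Rightarrow> Bar (split_map U x)) U)"

definition left_col :: "column \<Rightarrow> column" where
  "left_col U = sort (map (\<lambda>c. case c of Unb x \<Rightarrow> Unb (split_map U x) | Bar x \<Rightarrow> Bar x) U)"

section \<open>Symplectic tableaux\<close>

definition col_le :: "column \<Rightarrow> column \<Rightarrow> bool" where
  "col_le U V \<longleftrightarrow> length V \<le> length U \<and> (\<forall>k<length V. U ! k \<le> V ! k)"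

definition col_prec :: "column \<Rightarrow> column \<Rightarrow> bool" (infix "\<preceq>" 50) where
  "U \<preceq> V \<longleftrightarrow> col_le (right_col U) (left_col V)"

text \<open>A tableau is the list of its columns from left to right.\<close>

definition symplectic_tableau :: "nat \<Rightarrow> column list \<Rightarrow> bool" where
  "symplectic_tableau n T \<longleftrightarrow>
     (\<forall>U\<in>set T. U \<noteq> [] \<and> admissible n U) \<and> successively (\<preceq>) T"

definition tableau_reading :: "column list \<Rightarrow> word" where
  "tableau_reading T = concat (rev T)"

text \<open>\<open>is_P_tableau n w T\<close> says that \<open>T\<close> is the tableau \<open>P(w)\<close>. By a theorem of Lecouvey, exactly
  one such \<open>T\<close> exists for each word \<open>w\<close> over the alphabet of rank \<open>n\<close>.\<close>

definition is_P_tableau :: "nat \<Rightarrow> word \<Rightarrow> column list \<Rightarrow> bool" where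
  "is_P_tableau n w T \<longleftrightarrow> symplectic_tableau n T \<and> crystal_equiv n w (tableau_reading T)"

end

theory Submission
  imports Defs
begin

text \<open>For two-column words the condition \<open>V \<preceq> U\<close> can be expressed by inequalities between numbers of
  letters. A crystal operator changes these numbers at a single index, and its signature rule
  forces the inequalities to be preserved in both directions, so the tableau condition is constant
  on connected components. The source of the component of \<open>UV\<close> is \<open>1...p\<close> followed by an
  admissible column \<open>v\<close> with \<open>p = h(U)\<close>; that of the component of \<open>WW'\<close> is \<open>1...k 1...l\<close> with
  \<open>k = h(W) \<le> l\<close>. If \<open>p \<le> k\<close>, equality of weights puts all of \<open>1, ..., p\<close> into \<open>v\<close>, which forces
  \<open>v = 1...q\<close> with \<open>p \<le> q\<close>. This source satisfies the tableau condition, hence so does \<open>UV\<close>,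
  a contradiction.\<close>

section \<open>Signatures\<close>

text \<open>The obstacle is that splitting is not local: one crystal step can create a doubled
  letter and thereby re-pair several others, so \<open>rV\<close> and \<open>lU\<close> cannot be
  followed directly along arrows. Numbers of letters do change locally; the price is that the
  inequalities range over all pairs \<open>m \<le> k\<close> instead of single indices. At the index
  \<open>i\<close> of a step, such an inequality could fail only for lack of a slack of 1. The
  signature rule provides the slack, because the signs left over in one column have to be absorbed
  by the other. At the sources, the letter \<open>p\<close> is decisive. The prefix
  \<open>1...p\<close> leaves one plus, for \<open>i = p\<close>, which could absorb a letter
  \<open>p+1\<close> or a barred \<open>p\<close> in \<open>v\<close>. If \<open>p\<close> itself
  lies in \<open>v\<close>, the unbarred letters of \<open>v\<close> have no gaps, and a barred
  letter would then contradict admissibility.\<close>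

fun nominus :: "('a \<Rightarrow> int) \<Rightarrow> int \<Rightarrow> 'a list \<Rightarrow> bool" where
  "nominus s c [] \<longleftrightarrow> 0 \<le> c"
| "nominus s c (x # xs) \<longleftrightarrow> 0 \<le> c \<and> nominus s (c + s x) xs"

text \<open>With plus as 1 and minus as -1, \<open>nominus s c xs\<close> asks all prefix sums,
  started at \<open>c\<close>, to be nonnegative: bracketing leaves no minus when \<open>c\<close>
  free pluses stand to the left. \<open>noplus s c xs\<close> is the mirror image with suffix sums:
  no plus is left when \<open>- c\<close> free minuses stand to the right. The parameter
  \<open>c\<close> carries the signs of one factor of a word over to the next.\<close>

fun noplus :: "('a \<Rightarrow> int) \<Rightarrow> int \<Rightarrow> 'a list \<Rightarrow> bool" where
  "noplus s c [] \<longleftrightarrow> c \<le> 0"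
| "noplus s c (x # xs) \<longleftrightarrow> noplus s c xs \<and> s x + sum_list (map s xs) + c \<le> 0"

lemma nominus_nonneg: "nominus s c xs \<Longrightarrow> 0 \<le> c"
  by (cases xs) auto

lemma nominus_total: "nominus s c xs \<Longrightarrow> 0 \<le> c + sum_list (map s xs)"
proof (induction xs arbitrary: c)
  case (Cons x xs)
  have "0 \<le> (c + s x) + sum_list (map s xs)" using Cons.prems by (intro Cons.IH) simp
  then show ?case by simp
qed simp

lemma noplus_total: "noplus s c xs \<Longrightarrow> sum_list (map s xs) + c \<le> 0"
  by (cases xs) auto

lemma nominus_append:
  "nominus s c (xs @ ys) \<longleftrightarrow> nominus s c xs \<and> nominus s (c + sum_list (map s xs)) ys"
  by (induction xs arbitrary: c) (auto simp: algebra_simps dest: nominus_nonneg)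

lemma noplus_append:
  "noplus s c (xs @ ys) \<longleftrightarrow> noplus s c ys \<and> noplus s (sum_list (map s ys) + c) xs"
  by (induction xs) (auto simp: algebra_simps dest: noplus_total)

lemma nominus_map: "nominus s c (map f xs) \<longleftrightarrow> nominus (\<lambda>x. s (f x)) c xs"
  by (induction xs arbitrary: c) auto

lemma noplus_map: "noplus s c (map f xs) \<longleftrightarrow> noplus (\<lambda>x. s (f x)) c xs"
  by (induction xs) (auto simp: o_def)

lemma nominus_filter:
  assumes "\<And>x. \<not> R x \<Longrightarrow> s x = 0" and "nominus s c xs"
  shows "nominus s c (filter R xs)"
  using assms(2) by (induction xs arbitrary: c) (auto simp: assms(1))

lemma sum_list_filter_sign:
  assumes "\<And>x. \<not> R x \<Longrightarrow> s x = (0::int)"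
  shows "sum_list (map s (filter R xs)) = sum_list (map s xs)"
  by (induction xs) (auto simp: assms)

lemma noplus_filter:
  assumes "\<And>x. \<not> R x \<Longrightarrow> s x = 0" and "noplus s c xs"
  shows "noplus s c (filter R xs)"
  using assms(2) by (induction xs) (auto simp: sum_list_filter_sign[of R s] assms(1))

text \<open>The letter \<open>y\<close> is where the partial sums of the signs first reach their minimum.\<close>

lemma not_nominus_split:
  assumes "\<And>x. s x \<in> {-1, 0, 1}" and "0 \<le> c" and "\<not> nominus s c xs"
  shows "\<exists>ys y zs. xs = ys @ y # zs \<and> s y = -1 \<and> noplus s 0 ys \<and> nominus s 0 zs \<and>
           c + sum_list (map s ys) \<le> 0"
  using assms(2,3)
proof (induction xs arbitrary: c)
  case (Cons x xs)
  have extend: ?case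
    if c': "0 \<le> c'" "\<not> nominus s c' xs" "c + s x \<le> c'" for c'
  proof -
    obtain ys y zs where d: "xs = ys @ y # zs" "s y = -1" "noplus s 0 ys" "nominus s 0 zs"
      "c' + sum_list (map s ys) \<le> 0"
      using Cons.IH[OF c'(1,2)] by blast
    have "c + s x + sum_list (map s ys) \<le> 0" using d(5) c'(3) by linarith
    then show ?thesis
      using d Cons.prems by (intro exI[of _ "x # ys"] exI[of _ y] exI[of _ zs]) auto
  qed
  have n: "\<not> nominus s (c + s x) xs" using Cons.prems by simp
  show ?case
  proof (cases "0 \<le> c + s x")
    case True
    then show ?thesis using extend[of "c + s x"] n by simp
  next
    case False
    then have cx: "c = 0" "s x = -1" using assms(1)[of x] Cons.prems(1) by auto
    \<comment> \<open>The credit is used up and \<open>x\<close> is an unmatched minus. It is the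
      last one if the rest is harmless from credit 0; otherwise the search restarts there from
      0.\<close>
    show ?thesis
    proof (cases "nominus s 0 xs")
      case True
      then show ?thesis using cx by (intro exI[of _ "[]"] exI[of _ x] exI[of _ xs]) auto
    next
      case False
      then show ?thesis using extend[of 0] cx by simp
    qed
  qed
qed simp

lemma sum_list_map_uminus: "sum_list (map (\<lambda>x. - s x) xs) = - sum_list (map s xs :: int list)"
  by (induction xs) auto

text \<open>Reading backwards with opposite signs turns the bracketing into itself and exchanges the
  two conditions.\<close>

lemma nominus_uminus_rev: "nominus (\<lambda>x. - s x) c (rev xs) \<longleftrightarrow> noplus s (- c) xs"
proof (induction xs arbitrary: c)
  case (Cons x xs)
  have "sum_list (map (\<lambda>x. - s x) (rev xs)) = - sum_list (map s xs)"
    using sum_list_map_uminus[of s "rev xs"] by (simp add: rev_map[symmetric])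
  then show ?case
    using Cons.IH[of c] nominus_total[of "\<lambda>x. - s x" c "rev xs"]
    by (auto simp: nominus_append)
qed auto

lemma noplus_uminus_rev: "noplus (\<lambda>x. - s x) c (rev xs) \<longleftrightarrow> nominus s (- c) xs"
  using nominus_uminus_rev[of "\<lambda>x. - s x" "- c" "rev xs"] by simp

text \<open>Mirror image of the splitting at a minus: here \<open>y\<close> is the leftmost
  surviving plus, the letter that \<open>f_op\<close> changes.\<close>

lemma not_noplus_split:
  assumes "\<And>x. s x \<in> {-1, 0, 1}" and "\<not> noplus s 0 xs"
  shows "\<exists>ys y zs. xs = ys @ y # zs \<and> s y = 1 \<and> noplus s 0 ys \<and> nominus s 0 zs"
proof -
  have "\<And>x. - s x \<in> {-1, 0, 1}" using assms(1) by force
  moreover have "\<not> nominus (\<lambda>x. - s x) 0 (rev xs)"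
    using assms(2) by (simp add: nominus_uminus_rev)
  ultimately obtain ys y zs where d: "rev xs = ys @ y # zs" "- s y = -1"
    "noplus (\<lambda>x. - s x) 0 ys" "nominus (\<lambda>x. - s x) 0 zs"
    using not_nominus_split[of "\<lambda>x. - s x" 0 "rev xs"] by auto
  have "xs = rev zs @ y # rev ys" using d(1) by (metis append.assoc append_Cons append_Nil rev.simps(2) rev_append rev_rev_ident)
  moreover have "noplus s 0 (rev zs)" using nominus_uminus_rev[of s 0 "rev zs"] d(4) by simp
  moreover have "nominus s 0 (rev ys)" using noplus_uminus_rev[of s 0 "rev ys"] d(3) by simp
  ultimately show ?thesis using d(2) by force
qed

section \<open>Bracketing and partial sums\<close>

context
  fixes p m :: "'a \<Rightarrow> bool" and s :: "'a \<Rightarrow> int"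
  assumes sp: "\<And>x. p x \<Longrightarrow> s x = 1" and sm: "\<And>x. m x \<Longrightarrow> s x = -1"
begin

lemma nominus_del_pair: "del_pair p m xs ys \<Longrightarrow> nominus s c xs \<Longrightarrow> nominus s c ys"
  by (induction rule: del_pair.induct) (auto simp: nominus_append sp sm)

lemma noplus_del_pair: "del_pair p m xs ys \<Longrightarrow> noplus s c xs \<Longrightarrow> noplus s c ys"
  by (induction rule: del_pair.induct) (auto simp: noplus_append sp sm)

lemma nominus_cancel: "nominus s c xs \<Longrightarrow> nominus s c (cancel p m xs)"
  using cancel_reachable[of p m xs]
  by (induction rule: rtranclp_induct) (auto intro: nominus_del_pair)

lemma noplus_cancel: "noplus s c xs \<Longrightarrow> noplus s c (cancel p m xs)"
  using cancel_reachable[of p m xs]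
  by (induction rule: rtranclp_induct) (auto intro: noplus_del_pair)

lemma set_cancel: "set (cancel p m xs) \<subseteq> set xs"
  by (induction xs) (auto split: list.splits)

text \<open>A normal form consists of minuses followed by pluses, so a surviving minus would stand
  first, where the prefix sum is -1.\<close>

lemma cancel_only_plus:
  assumes "nominus s 0 xs" and "\<forall>x\<in>set xs. p x \<or> m x"
  shows "\<forall>x\<in>set (cancel p m xs). \<not> m x"
proof -
  have sorted: "(\<exists>x\<in>set zs. m x) \<Longrightarrow> m (hd zs)"
    if "successively (\<lambda>x y. \<not> (p x \<and> m y)) zs" "\<forall>x\<in>set zs. p x \<or> m x" for zs
    using that by (induction zs) (auto simp: successively_Cons)
  have "nominus s 0 (cancel p m xs)" using assms(1) by (rule nominus_cancel)
  then have "cancel p m xs \<noteq> [] \<Longrightarrow> \<not> m (hd (cancel p m xs))"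
    by (cases "cancel p m xs") (auto simp: sm dest: nominus_nonneg)
  then show ?thesis
    using sorted[OF cancel_successively, of xs] set_cancel[of xs] assms(2) by fastforce
qed

text \<open>From a surviving plus on, the normal form has only pluses, and this suffix would have a
  positive sum.\<close>

lemma cancel_only_minus:
  assumes "noplus s 0 xs" and "\<forall>x\<in>set xs. p x \<or> m x"
  shows "\<forall>x\<in>set (cancel p m xs). \<not> p x"
proof
  fix x assume "x \<in> set (cancel p m xs)"
  then obtain as bs where d: "cancel p m xs = as @ x # bs" by (meson split_list)
  have all_plus: "\<forall>z\<in>set zs. p z"
    if "successively (\<lambda>x y. \<not> (p x \<and> m y)) (y # zs)" "\<forall>x\<in>set zs. p x \<or> m x" "p y" for y zs
    using that
  proof (induction zs arbitrary: y)
    case (Cons z zs)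
    have "p z" using Cons.prems by (simp add: successively_Cons)
    moreover have "\<forall>z\<in>set zs. p z"
      by (rule Cons.IH[of z]) (use Cons.prems \<open>p z\<close> in \<open>simp_all\<close>)
    ultimately show ?case by simp
  qed simp
  show "\<not> p x"
  proof
    assume "p x"
    have "\<forall>y\<in>set bs. p y"
      using cancel_successively[of p m xs] \<open>p x\<close> set_cancel[of xs] assms(2)
      by (intro all_plus[of x]) (auto simp: d successively_append_iff)
    then have "0 \<le> sum_list (map s bs)" by (induction bs) (auto simp: sp)
    moreover have "s x + sum_list (map s bs) \<le> 0"
      using noplus_cancel[OF assms(1)] noplus_total[of s 0 "x # bs"] by (simp add: d noplus_append)
    ultimately show False using sp[OF \<open>p x\<close>] by simp
  qed
qed

end

text \<open>Evaluation runs from the right, so the letters of \<open>xs\<close> meet the reduced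
  form of \<open>ys\<close>; without a minus there, none of them can be cancelled against
  it.\<close>

lemma cancel_append:
  assumes "\<forall>y\<in>set (cancel p m ys). \<not> m y"
  shows "cancel p m (xs @ ys) = cancel p m xs @ cancel p m ys"
proof (induction xs)
  case (Cons x xs)
  then show ?case using assms by (auto split: list.splits)
qed simp

section \<open>Crystal operators as factorizations of words\<close>

definition sign_at :: "nat \<Rightarrow> nat \<Rightarrow> letter \<Rightarrow> int" where
  "sign_at n i x = of_bool (is_plus n i x) - of_bool (is_minus n i x)"

abbreviation "no_plus n i \<equiv> noplus (sign_at n i) 0"
abbreviation "no_minus n i \<equiv> nominus (sign_at n i) 0"
abbreviation "sign_sum n i w \<equiv> sum_list (map (sign_at n i) w)"

lemma not_plus_and_minus: "\<not> (is_plus n i x \<and> is_minus n i x)"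
  by (auto simp: is_plus_def is_minus_def)

lemma sign_at_plus: "is_plus n i x \<Longrightarrow> sign_at n i x = 1"
  and sign_at_minus: "is_minus n i x \<Longrightarrow> sign_at n i x = -1"
  and sign_at_zero: "\<not> (is_plus n i x \<or> is_minus n i x) \<Longrightarrow> sign_at n i x = 0"
  using not_plus_and_minus[of n i x] by (auto simp: sign_at_def)

lemma sign_at_range: "sign_at n i x \<in> {-1, 0, 1}"
  by (auto simp: sign_at_def)

lemma sign_at_eq: "sign_at n i x = 1 \<longleftrightarrow> is_plus n i x" "sign_at n i x = -1 \<longleftrightarrow> is_minus n i x"
  using not_plus_and_minus[of n i x] by (auto simp: sign_at_def)

text \<open>Replaces the position lists of \<open>unmatched\<close> by a factorization of the word
  at the changed letter. Both side conditions pass to subwords next to \<open>x\<close>, which is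
  what makes a step in a word of two columns a step in one of them.\<close>

definition f_step :: "nat \<Rightarrow> nat \<Rightarrow> word \<Rightarrow> letter \<Rightarrow> word \<Rightarrow> bool" where
  "f_step n i xs x ys \<longleftrightarrow> is_plus n i x \<and> no_plus n i xs \<and> no_minus n i ys"

lemma f_op_f_step:
  assumes "f_step n i xs x ys"
  shows "f_op n i (xs @ x # ys) = Some (xs @ f_letter n i x # ys)"
proof -
  define w where "w = xs @ x # ys"
  define P where "P = (\<lambda>k. is_plus n i (w ! k))"
  define M where "M = (\<lambda>k. is_minus n i (w ! k))"
  define A where "A = filter (\<lambda>k. P k \<or> M k) [0..<length xs]"
  define B where "B = filter (\<lambda>k. P k \<or> M k) [Suc (length xs)..<length w]"
  have P: "P (length xs)" and M: "\<not> M (length xs)"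
    using assms not_plus_and_minus[of n i x] by (auto simp: f_step_def P_def M_def w_def)
  have sgn: "\<And>k. P k \<Longrightarrow> sign_at n i (w ! k) = 1" "\<And>k. M k \<Longrightarrow> sign_at n i (w ! k) = -1"
    "\<And>k. \<not> (P k \<or> M k) \<Longrightarrow> sign_at n i (w ! k) = 0"
    using sign_at_plus sign_at_minus sign_at_zero by (auto simp: P_def M_def)
  have range: "[0..<length w] = [0..<length xs] @ length xs # [Suc (length xs)..<length w]"
    using upt_add_eq_append[of 0 "length xs" "Suc (length ys)"]
      upt_conv_Cons[of "length xs" "length xs + Suc (length ys)"] by (simp add: w_def)
  have xs: "map ((!) w) [0..<length xs] = xs"
    by (intro nth_equalityI) (auto simp: w_def nth_append)
  have ys: "map ((!) w) [Suc (length xs)..<length w] = ys"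
    using map_nth[of w] xs unfolding range by (simp add: w_def del: upt_Suc)
  have "noplus (\<lambda>k. sign_at n i (w ! k)) 0 [0..<length xs]"
    using assms noplus_map[of "sign_at n i" 0 "(!) w" "[0..<length xs]"] xs by (simp add: f_step_def)
  then have "noplus (\<lambda>k. sign_at n i (w ! k)) 0 A"
    unfolding A_def by (rule noplus_filter[rotated]) (rule sgn(3))
  then have A: "\<forall>k\<in>set (cancel P M A). \<not> P k"
    by (rule cancel_only_minus[rotated 2]) (auto simp: A_def sgn)
  have "nominus (\<lambda>k. sign_at n i (w ! k)) 0 [Suc (length xs)..<length w]"
    using assms nominus_map[of "sign_at n i" 0 "(!) w" "[Suc (length xs)..<length w]"] ys
    by (simp add: f_step_def)
  then have "nominus (\<lambda>k. sign_at n i (w ! k)) 0 B"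
    unfolding B_def by (rule nominus_filter[rotated]) (rule sgn(3))
  then have B: "\<forall>k\<in>set (cancel P M B). \<not> M k"
    by (rule cancel_only_plus[rotated 2]) (auto simp: B_def sgn)
  \<comment> \<open>The reduced right part has no minus to cancel the plus at \<open>x\<close>;
    being a plus, \<open>x\<close> in turn cancels nothing on its left.\<close>
  have "cancel P M (length xs # B) = length xs # cancel P M B"
    using B P by (auto split: list.splits)
  then have c: "cancel P M (A @ length xs # B) = cancel P M A @ length xs # cancel P M B"
    using cancel_append[of P M "length xs # B" A] B M by simp
  have "unmatched n i w = cancel P M (filter (\<lambda>k. P k \<or> M k) [0..<length w])"
    by (simp add: unmatched_def P_def M_def)
  also have "\<dots> = cancel P M (A @ length xs # B)"
    using P by (simp add: range A_def B_def del: upt_Suc cancel.simps)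
  finally have "unmatched n i w = cancel P M A @ length xs # cancel P M B" using c by simp
  moreover have "filter P (cancel P M A) = []" using A by (simp add: filter_empty_conv)
  ultimately have "filter P (unmatched n i w) = length xs # filter P (cancel P M B)"
    using P by simp
  then show ?thesis
    unfolding f_op_def w_def[symmetric] P_def[symmetric] by (simp add: w_def)
qed

lemma f_op_None:
  assumes "no_plus n i w"
  shows "f_op n i w = None"
proof -
  have "map ((!) w) [0..<length w] = w" by (rule map_nth)
  then have "noplus (\<lambda>k. sign_at n i (w ! k)) 0 [0..<length w]"
    using assms noplus_map[of "sign_at n i" 0 "(!) w" "[0..<length w]"] by simp
  then have "noplus (\<lambda>k. sign_at n i (w ! k)) 0
      (filter (\<lambda>k. is_plus n i (w ! k) \<or> is_minus n i (w ! k)) [0..<length w])"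
    by (rule noplus_filter[rotated]) (rule sign_at_zero)
  then have "\<forall>k\<in>set (unmatched n i w). \<not> is_plus n i (w ! k)"
    unfolding unmatched_def
    by (rule cancel_only_minus[rotated 2]) (auto simp: sign_at_plus sign_at_minus)
  then have "filter (\<lambda>k. is_plus n i (w ! k)) (unmatched n i w) = []"
    by (simp add: filter_empty_conv)
  then show ?thesis by (simp add: f_op_def)
qed

lemma f_op_Some_iff:
  "f_op n i w = Some w' \<longleftrightarrow>
     (\<exists>xs x ys. w = xs @ x # ys \<and> w' = xs @ f_letter n i x # ys \<and> f_step n i xs x ys)"
proof
  assume f: "f_op n i w = Some w'"
  then have "\<not> no_plus n i w" using f_op_None by fastforce
  then obtain xs x ys where d: "w = xs @ x # ys" "f_step n i xs x ys"
    using not_noplus_split[of "sign_at n i" w] sign_at_range by (auto simp: f_step_def sign_at_eq)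
  then show "\<exists>xs x ys. w = xs @ x # ys \<and> w' = xs @ f_letter n i x # ys \<and> f_step n i xs x ys"
    using f f_op_f_step[OF d(2)] by auto
qed (auto simp: f_op_f_step)

text \<open>The preimage is the word that the raising operator would produce: the rightmost
  surviving minus \<open>y\<close> is changed back to the plus \<open>x\<close>. Incoming arrows can
  thus be treated with \<open>f_op\<close> alone.\<close>

lemma not_no_minus_f_op:
  assumes "\<not> no_minus n i w"
  shows "\<exists>xs x ys. w = xs @ f_letter n i x # ys \<and> f_step n i xs x ys \<and>
           f_op n i (xs @ x # ys) = Some w"
proof -
  obtain xs y ys where d: "w = xs @ y # ys" "is_minus n i y" "no_plus n i xs" "no_minus n i ys"
    using not_nominus_split[of "sign_at n i" 0 w] sign_at_range assms by (auto simp: sign_at_eq)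
  obtain x where x: "is_plus n i x" "f_letter n i x = y"
  proof (cases y)
    case (Unb j)
    then show ?thesis using d(2) that[of "Unb i"] by (auto simp: is_minus_def is_plus_def)
  next
    case (Bar j)
    then show ?thesis
      using d(2) that[of "Unb i"] that[of "Bar (Suc i)"]
      by (cases "i < n") (auto simp: is_minus_def is_plus_def)
  qed
  then have "f_step n i xs x ys" using d by (simp add: f_step_def)
  then show ?thesis using d(1) x(2) f_op_f_step by blast
qed

section \<open>Counting letters of columns\<close>

lemma letter_le_simps [simp]:
  "Unb i \<le> Unb j \<longleftrightarrow> i \<le> j" "Unb i \<le> Bar j" "\<not> Bar i \<le> Unb j" "Bar i \<le> Bar j \<longleftrightarrow> j \<le> i"
  by (auto simp: less_eq_letter_def)

definition unb_count :: "column \<Rightarrow> nat \<Rightarrow> int" where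
  "unb_count U m = int (length (filter (\<lambda>x. x \<le> Unb m) U))"

definition bar_count :: "column \<Rightarrow> nat \<Rightarrow> int" where
  "bar_count U m = int (length (filter (\<lambda>x. Bar m \<le> x) U))"

text \<open>On a column this is the number \<open>N(m)\<close> of the admissibility condition, since
  no letter is both at most \<open>Unb m\<close> and at least \<open>Bar m\<close>.\<close>

definition abs_count :: "column \<Rightarrow> nat \<Rightarrow> int" where
  "abs_count U m = unb_count U m + bar_count U m"

lemma unb_count_Nil [simp]: "unb_count [] m = 0"
  and unb_count_Cons: "unb_count (x # xs) m = of_bool (x \<le> Unb m) + unb_count xs m"
  and unb_count_append: "unb_count (xs @ ys) m = unb_count xs m + unb_count ys m"
  by (auto simp: unb_count_def)

lemma bar_count_Nil [simp]: "bar_count [] m = 0"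
  and bar_count_Cons: "bar_count (x # xs) m = of_bool (Bar m \<le> x) + bar_count xs m"
  and bar_count_append: "bar_count (xs @ ys) m = bar_count xs m + bar_count ys m"
  by (auto simp: bar_count_def)

lemma unb_count_Suc:
  "distinct U \<Longrightarrow> unb_count U (Suc m) = unb_count U m + of_bool (Unb (Suc m) \<in> set U)"
proof (induction U)
  case (Cons x U)
  then show ?case by (cases x) (auto simp: unb_count_Cons le_Suc_eq)
qed simp

lemma bar_count_Suc:
  "distinct U \<Longrightarrow> bar_count U (Suc m) = bar_count U m + of_bool (Bar (Suc m) \<in> set U)"
proof (induction U)
  case (Cons x U)
  then show ?case by (cases x) (auto simp: bar_count_Cons le_Suc_eq)
qed simp

lemma is_column_distinct: "is_column n U \<Longrightarrow> distinct U"
  unfolding is_column_def using strict_sorted_iff by blast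

lemma is_column_letter:
  assumes "is_column n U" "x \<in> set U"
  obtains j where "1 \<le> j" "j \<le> n" "x = Unb j \<or> x = Bar j"
  using assms by (auto simp: is_column_def alphabet_def)

lemma counts_0:
  assumes "is_column n U"
  shows "unb_count U 0 = 0" "bar_count U 0 = 0" "abs_count U 0 = 0"
proof -
  have "\<not> x \<le> Unb 0" "\<not> Bar 0 \<le> x" if "x \<in> set U" for x
    using is_column_letter[OF assms that] by force+
  then show "unb_count U 0 = 0" "bar_count U 0 = 0"
    by (auto simp: unb_count_def bar_count_def)
  then show "abs_count U 0 = 0" by (simp add: abs_count_def)
qed

lemma abs_count_eq_length:
  assumes "is_column n U"
  shows "abs_count U n = int (length U)"
proof -
  have "set U \<subseteq> alphabet n" using assms by (simp add: is_column_def)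
  then show ?thesis
    by (induction U) (auto simp: abs_count_def unb_count_Cons bar_count_Cons alphabet_def)
qed

lemma abs_count_Suc:
  "distinct U \<Longrightarrow> abs_count U (Suc m) =
     abs_count U m + of_bool (Unb (Suc m) \<in> set U) + of_bool (Bar (Suc m) \<in> set U)"
  by (simp add: abs_count_def unb_count_Suc bar_count_Suc)

lemma card_abs_count:
  assumes "distinct U"
  shows "int (card {x \<in> set U. x \<le> Unb m \<or> Bar m \<le> x}) = abs_count U m"
proof -
  have "{x \<in> set U. x \<le> Unb m \<or> Bar m \<le> x} = set (filter (\<lambda>x. x \<le> Unb m) U @ filter (\<lambda>x. Bar m \<le> x) U)"
    by auto
  moreover have "distinct (filter (\<lambda>x. x \<le> Unb m) U @ filter (\<lambda>x. Bar m \<le> x) U)"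
    using assms order_trans[of "Bar m" _ "Unb m"] by auto
  ultimately show ?thesis
    by (metis (no_types, lifting) distinct_card abs_count_def bar_count_def unb_count_def length_append of_nat_add)
qed

lemma admissible_iff:
  "admissible n U \<longleftrightarrow> is_column n U \<and> (\<forall>m\<le>n. abs_count U m \<le> int m)"
proof -
  have "card {x \<in> set U. x \<le> Unb m \<or> Bar m \<le> x} \<le> m \<longleftrightarrow> abs_count U m \<le> int m"
    if "is_column n U" for m
    using card_abs_count[OF is_column_distinct[OF that], of m] by linarith
  moreover have "abs_count U 0 = 0" if "is_column n U" using counts_0[OF that] by simp
  ultimately show ?thesis
    unfolding admissible_def by (auto simp: Ball_def) (metis Suc_leI bot_nat_0.not_eq_extremum of_nat_0 order_refl)
qed

section \<open>Signatures of columns\<close>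

text \<open>In a sorted list the elements below \<open>t\<close> form a prefix, and
  \<open>nominus\<close> bounds every prefix sum.\<close>

lemma nominus_below:
  fixes xs :: "'a::linorder list"
  assumes "sorted_wrt (<) xs" "nominus s c xs"
  shows "0 \<le> c + sum_list (map s (filter (\<lambda>y. y < t) xs))"
  using assms
proof (induction xs arbitrary: c)
  case (Cons x xs)
  show ?case
  proof (cases "x < t")
    case True
    have "0 \<le> (c + s x) + sum_list (map s (filter (\<lambda>y. y < t) xs))"
      using Cons.prems by (intro Cons.IH) auto
    then show ?thesis using True by simp
  next
    case False
    have "\<forall>y\<in>set (x # xs). x \<le> y" using Cons.prems(1) by auto
    then have "filter (\<lambda>y. y < t) (x # xs) = []"
      using False unfolding filter_empty_conv by (meson le_less_trans)
    then show ?thesis using Cons.prems(2) nominus_nonneg by fastforce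
  qed
qed simp

lemma noplus_above:
  fixes xs :: "'a::linorder list"
  assumes "sorted_wrt (<) xs" "noplus s c xs"
  shows "sum_list (map s (filter (\<lambda>y. t \<le> y) xs)) + c \<le> 0"
  using assms
proof (induction xs)
  case (Cons x xs)
  show ?case
  proof (cases "t \<le> x")
    case True
    have "\<forall>y\<in>set (x # xs). x \<le> y" using Cons.prems(1) by auto
    then have "filter (\<lambda>y. t \<le> y) (x # xs) = x # xs"
      using True unfolding filter_id_conv by (meson order_trans)
    then show ?thesis using noplus_total[OF Cons.prems(2)] by presburger
  next
    case False
    have "sum_list (map s (filter (\<lambda>y. t \<le> y) xs)) + c \<le> 0"
      using Cons.prems by (intro Cons.IH) auto
    then show ?thesis using False by simp
  qed
qed simp

lemma sign_sum_distinct: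
  assumes "distinct xs"
  shows "i < n \<Longrightarrow> sign_sum n i xs = of_bool (Unb i \<in> set xs) - of_bool (Unb (Suc i) \<in> set xs) +
           of_bool (Bar (Suc i) \<in> set xs) - of_bool (Bar i \<in> set xs)"
    and "sign_sum n n xs = of_bool (Unb n \<in> set xs) - of_bool (Bar n \<in> set xs)"
  using assms
  by (induction xs) (auto simp: sign_at_def is_plus_def is_minus_def)

text \<open>In a column the relevant letters occur in the order \<open>Unb i\<close>,
  \<open>Unb (Suc i)\<close>, \<open>Bar (Suc i)\<close>, \<open>Bar i\<close> with signs + - + -.
  Only the prefix sums after the two minuses matter; cutting at \<open>Bar (Suc i)\<close> gives the
  first, the whole column the second.\<close>

lemma nominus_column:
  assumes "sorted_wrt (<) xs" "nominus (sign_at n i) c xs"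
  shows "i < n \<Longrightarrow> 0 \<le> c + of_bool (Unb i \<in> set xs) - of_bool (Unb (Suc i) \<in> set xs)"
    and "i < n \<Longrightarrow> 0 \<le> c + of_bool (Unb i \<in> set xs) - of_bool (Unb (Suc i) \<in> set xs) +
           of_bool (Bar (Suc i) \<in> set xs) - of_bool (Bar i \<in> set xs)"
    and "i = n \<Longrightarrow> 0 \<le> c + of_bool (Unb n \<in> set xs) - of_bool (Bar n \<in> set xs)"
proof -
  have d: "distinct xs" using assms(1) strict_sorted_iff by blast
  show "0 \<le> c + of_bool (Unb i \<in> set xs) - of_bool (Unb (Suc i) \<in> set xs)" if "i < n"
    using nominus_below[OF assms, of "Bar (Suc i)"] sign_sum_distinct(1)[OF distinct_filter[OF d] that] by simp
  show "i < n \<Longrightarrow> 0 \<le> c + of_bool (Unb i \<in> set xs) - of_bool (Unb (Suc i) \<in> set xs) +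
           of_bool (Bar (Suc i) \<in> set xs) - of_bool (Bar i \<in> set xs)"
    "i = n \<Longrightarrow> 0 \<le> c + of_bool (Unb n \<in> set xs) - of_bool (Bar n \<in> set xs)"
    using nominus_total[OF assms(2)] sign_sum_distinct[OF d] by (simp_all add: algebra_simps)
qed

lemma noplus_column:
  assumes "sorted_wrt (<) xs" "noplus (sign_at n i) c xs"
  shows "i < n \<Longrightarrow> of_bool (Bar (Suc i) \<in> set xs) - of_bool (Bar i \<in> set xs) + c \<le> 0"
    and "i < n \<Longrightarrow> of_bool (Unb i \<in> set xs) - of_bool (Unb (Suc i) \<in> set xs) +
           of_bool (Bar (Suc i) \<in> set xs) - of_bool (Bar i \<in> set xs) + c \<le> 0"
    and "i = n \<Longrightarrow> of_bool (Unb n \<in> set xs) - of_bool (Bar n \<in> set xs) + c \<le> 0"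
proof -
  have d: "distinct xs" using assms(1) strict_sorted_iff by blast
  show "of_bool (Bar (Suc i) \<in> set xs) - of_bool (Bar i \<in> set xs) + c \<le> 0" if "i < n"
    using noplus_above[OF assms, of "Bar (Suc i)"] sign_sum_distinct(1)[OF distinct_filter[OF d] that] by simp
  show "i < n \<Longrightarrow> of_bool (Unb i \<in> set xs) - of_bool (Unb (Suc i) \<in> set xs) +
           of_bool (Bar (Suc i) \<in> set xs) - of_bool (Bar i \<in> set xs) + c \<le> 0"
    "i = n \<Longrightarrow> of_bool (Unb n \<in> set xs) - of_bool (Bar n \<in> set xs) + c \<le> 0"
    using noplus_total[OF assms(2)] sign_sum_distinct[OF d] by (simp_all add: algebra_simps)
qed

lemma f_step_cases:
  assumes "f_step n i xs x ys" "i \<le> n"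
  obtains (unb) "i < n" "x = Unb i" "f_letter n i x = Unb (Suc i)"
    | (bar) "i < n" "x = Bar (Suc i)" "f_letter n i x = Bar i"
    | (last) "i = n" "x = Unb n" "f_letter n i x = Bar n"
  using assms by (cases "i < n") (auto simp: f_step_def is_plus_def)

lemma is_column_insert:
  "is_column n (xs @ x # ys) \<longleftrightarrow> x \<in> alphabet n \<and> is_column n xs \<and> is_column n ys \<and>
     (\<forall>z\<in>set xs. z < x) \<and> (\<forall>z\<in>set ys. x < z) \<and> (\<forall>y\<in>set xs. \<forall>z\<in>set ys. y < z)"
  by (auto simp: is_column_def sorted_wrt_append)

text \<open>The changed letter moves to a neighbouring place of the alphabet, so only a repeated
  letter could spoil strictness. A second copy of the new letter in \<open>ys\<close> would be a
  surviving minus, and a copy of the old one in \<open>xs\<close> a surviving plus.\<close>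

lemma is_column_f_step:
  assumes "f_step n i xs x ys" "1 \<le> i" "i \<le> n"
  shows "is_column n (xs @ x # ys) \<longleftrightarrow> is_column n (xs @ f_letter n i x # ys)" (is "?L \<longleftrightarrow> ?R")
proof -
  have nm: "no_minus n i ys" and np: "no_plus n i xs" using assms(1) by (auto simp: f_step_def)
  have sxy: "sorted_wrt (<) xs" "sorted_wrt (<) ys" if "?L \<or> ?R"
    using that by (auto simp: is_column_insert) (auto simp: is_column_def)
  have less: "x < f_letter n i x"
    using assms(1,3) by (cases rule: f_step_cases) auto
  have alph: "x \<in> alphabet n" "f_letter n i x \<in> alphabet n"
    using assms by (auto simp: alphabet_def intro: f_step_cases[OF assms(1,3)])
  \<comment> \<open>For \<open>i = n\<close> the restriction to \<open>alphabet n\<close> matters: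
    letters of index above \<open>n\<close> lie between \<open>Unb n\<close> and
    \<open>Bar n\<close>.\<close>
  have mid: "z \<noteq> x \<Longrightarrow> z < x \<longleftrightarrow> z < f_letter n i x"
    "z \<noteq> f_letter n i x \<Longrightarrow> x < z \<longleftrightarrow> f_letter n i x < z" if "z \<in> alphabet n" for z
    using assms(1,3) that by (cases rule: f_step_cases; cases z; auto simp: alphabet_def)+
  have ys: "f_letter n i x \<notin> set ys" if L: "?L"
  proof -
    have ord: "\<And>z. z \<in> set ys \<Longrightarrow> x < z" using L by (auto simp: is_column_insert)
    have s: "sorted_wrt (<) ys" using sxy L by blast
    show ?thesis
      using assms(1,3)
    proof (cases rule: f_step_cases)
      case unb
      then have "Unb i \<notin> set ys" using ord by auto
      then show ?thesis using nominus_column(1)[OF s nm unb(1)] unb by (auto simp: of_bool_def split: if_splits)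
    next
      case bar
      then have "Unb i \<notin> set ys" "Bar (Suc i) \<notin> set ys"
        using ord[of "Unb i"] ord[of "Bar (Suc i)"] by auto
      then show ?thesis using nominus_column(2)[OF s nm bar(1)] bar by (auto simp: of_bool_def split: if_splits)
    next
      case last
      then have "Unb n \<notin> set ys" using ord by auto
      then show ?thesis using nominus_column(3)[OF s nm last(1)] last by (auto simp: of_bool_def split: if_splits)
    qed
  qed
  have xs: "x \<notin> set xs" if R: "?R"
  proof -
    have ord: "\<And>z. z \<in> set xs \<Longrightarrow> z < f_letter n i x" using R by (auto simp: is_column_insert)
    have s: "sorted_wrt (<) xs" using sxy R by blast
    show ?thesis
      using assms(1,3)
    proof (cases rule: f_step_cases)
      case unb
      then have "Unb (Suc i) \<notin> set xs" "Bar i \<notin> set xs"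
        using ord[of "Unb (Suc i)"] ord[of "Bar i"] by auto
      then show ?thesis using noplus_column(2)[OF s np unb(1)] unb by (auto simp: of_bool_def split: if_splits)
    next
      case bar
      then have "Bar i \<notin> set xs" using ord by auto
      then show ?thesis using noplus_column(1)[OF s np bar(1)] bar by (auto simp: of_bool_def split: if_splits)
    next
      case last
      then have "Bar n \<notin> set xs" using ord by auto
      then show ?thesis using noplus_column(3)[OF s np last(1)] last by (auto simp: of_bool_def split: if_splits)
    qed
  qed
  have sub: "set xs \<subseteq> alphabet n" "set ys \<subseteq> alphabet n" if "?L \<or> ?R"
    using that by (auto simp: is_column_def)
  show ?thesis
  proof
    assume L: ?L
    have "z < f_letter n i x" if "z \<in> set xs" for z
      using L less that unfolding is_column_insert by (meson order_less_trans)
    moreover have "f_letter n i x < z" if "z \<in> set ys" for z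
      using mid(2)[of z] ys[OF L] sub(2) L that unfolding is_column_insert by blast
    ultimately show ?R using L alph unfolding is_column_insert by blast
  next
    assume R: ?R
    have "z < x" if "z \<in> set xs" for z
      using mid(1)[of z] xs[OF R] sub(1) R that unfolding is_column_insert by blast
    moreover have "x < z" if "z \<in> set ys" for z
      using R less that unfolding is_column_insert by (meson order_less_trans)
    ultimately show ?L using R alph unfolding is_column_insert by blast
  qed
qed

section \<open>Counting form of the tableau condition\<close>

text \<open>Collects what a step does to one column. The sign sums of \<open>xs\<close> and
  \<open>ys\<close> are recorded because they are what a neighbouring column receives. In the last
  case \<open>m \<le> n\<close> is required: a letter that passes from \<open>Unb n\<close> to
  \<open>Bar n\<close> changes both counts at all \<open>m \<ge> n\<close>.\<close>

lemma column_f_step_cases: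
  assumes "f_step n i xs x ys" "i \<le> n"
    and "U = xs @ x # ys" "U' = xs @ f_letter n i x # ys" "is_column n U" "is_column n U'"
  obtains (unb) "i < n" "Unb i \<in> set U" "Unb (Suc i) \<notin> set U" "Unb i \<notin> set U'" "Unb (Suc i) \<in> set U'"
      "\<And>j. Bar j \<in> set U' \<longleftrightarrow> Bar j \<in> set U"
      "sign_sum n i xs = 0"
      "sign_sum n i ys = of_bool (Bar (Suc i) \<in> set U) - of_bool (Bar i \<in> set U)"
      "Bar i \<in> set U \<longrightarrow> Bar (Suc i) \<in> set U"
      "\<And>m. unb_count U' m = unb_count U m - of_bool (m = i)" "\<And>m. bar_count U' m = bar_count U m"
    | (bar) "i < n" "Bar (Suc i) \<in> set U" "Bar i \<notin> set U" "Bar (Suc i) \<notin> set U'" "Bar i \<in> set U'"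
      "\<And>j. Unb j \<in> set U' \<longleftrightarrow> Unb j \<in> set U"
      "sign_sum n i xs = of_bool (Unb i \<in> set U) - of_bool (Unb (Suc i) \<in> set U)"
      "sign_sum n i ys = 0"
      "Unb i \<in> set U \<longrightarrow> Unb (Suc i) \<in> set U"
      "\<And>m. unb_count U' m = unb_count U m" "\<And>m. bar_count U' m = bar_count U m + of_bool (m = i)"
    | (last) "i = n" "Unb n \<in> set U" "Bar n \<notin> set U" "Unb n \<notin> set U'" "Bar n \<in> set U'"
      "sign_sum n i xs = 0" "sign_sum n i ys = 0"
      "\<And>m. m \<le> n \<Longrightarrow> unb_count U' m = unb_count U m - of_bool (m = i)"
      "\<And>m. m \<le> n \<Longrightarrow> bar_count U' m = bar_count U m + of_bool (m = i)"
proof -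
  have nm: "no_minus n i ys" and np: "no_plus n i xs" using assms(1) by (auto simp: f_step_def)
  have U: "is_column n (xs @ x # ys)" "is_column n (xs @ f_letter n i x # ys)" using assms by auto
  then have s: "sorted_wrt (<) xs" "sorted_wrt (<) ys" by (auto simp: is_column_def sorted_wrt_append)
  then have d: "distinct xs" "distinct ys" using strict_sorted_iff by blast+
  have dU: "distinct (xs @ x # ys)" "distinct (xs @ f_letter n i x # ys)"
    using U is_column_distinct by blast+
  have ord: "\<And>z. z \<in> set xs \<Longrightarrow> z < x" "\<And>z. z \<in> set ys \<Longrightarrow> x < z"
    using U(1) by (auto simp: is_column_insert)
  note counts = unb_count_append unb_count_Cons bar_count_append bar_count_Cons
  show ?thesis
    using assms(1,2)
  proof (cases rule: f_step_cases)
    case c: unb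
    have n: "Unb i \<notin> set xs \<union> set ys" "Unb (Suc i) \<notin> set xs \<union> set ys"
      using dU c by auto
    moreover have "Bar j \<notin> set xs" for j using ord(1)[of "Bar j"] c by auto
    moreover have "sign_sum n i ys \<ge> 0" using nominus_total[OF nm] by simp
    ultimately show ?thesis
      using c sign_sum_distinct(1)[OF d(1) c(1)] sign_sum_distinct(1)[OF d(2) c(1)]
      by (intro that(1)) (auto simp: assms(3,4) counts split: if_splits)
  next
    case c: bar
    have n: "Bar i \<notin> set xs \<union> set ys" "Bar (Suc i) \<notin> set xs \<union> set ys"
      using dU c by auto
    moreover have "Unb j \<notin> set ys" for j using ord(2)[of "Unb j"] c by auto
    moreover have "sign_sum n i xs \<le> 0" using noplus_total[OF np] by simp
    ultimately show ?thesis
      using c sign_sum_distinct(1)[OF d(1) c(1)] sign_sum_distinct(1)[OF d(2) c(1)]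
      by (intro that(2)) (auto simp: assms(3,4) counts split: if_splits)
  next
    case c: last
    have n: "Unb n \<notin> set xs \<union> set ys" "Bar n \<notin> set xs \<union> set ys"
      using dU c by auto
    then show ?thesis
      using c sign_sum_distinct(2)[OF d(1)] sign_sum_distinct(2)[OF d(2)]
      by (intro that(3)) (auto simp: assms(3,4) counts split: if_splits)
  qed
qed

text \<open>Only \<open>N(i)\<close> changes, by at most 1, and where it grows there is room: either
  neither letter of index \<open>i\<close> is in the column, so that \<open>N(i) = N(i-1)\<close>,
  or both letters of index \<open>i+1\<close> are, so that \<open>N(i) = N(i+1) - 2\<close>.\<close>

lemma admissible_f_step:
  assumes st: "f_step n i xs x ys" "1 \<le> i" "i \<le> n"
  shows "admissible n (xs @ x # ys) \<longleftrightarrow> admissible n (xs @ f_letter n i x # ys)"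
proof (cases "is_column n (xs @ x # ys)")
  case True
  define U where "U = xs @ x # ys"
  define U' where "U' = xs @ f_letter n i x # ys"
  have col: "is_column n U" "is_column n U'"
    using True is_column_f_step[OF assms] by (auto simp: U_def U'_def)
  obtain j where j: "i = Suc j" using assms(2) by (cases i) auto
  note Suc = abs_count_Suc[OF is_column_distinct[OF col(1)]]
    abs_count_Suc[OF is_column_distinct[OF col(2)]]
  have "(\<forall>m\<le>n. abs_count U m \<le> int m) \<longleftrightarrow> (\<forall>m\<le>n. abs_count U' m \<le> int m)"
    using st(1,3) U_def U'_def col
  proof (cases rule: column_f_step_cases)
    case unb
    have e: "abs_count U' m = abs_count U m - of_bool (m = i)" for m
      using unb by (simp add: abs_count_def)
    have "abs_count U i \<le> int i" if a: "\<forall>m\<le>n. abs_count U' m \<le> int m"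
      using a[rule_format, of j] a[rule_format, of i] a[rule_format, of "Suc i"] unb Suc(2)[of j] Suc(2)[of i] e
      by (auto simp: j of_bool_def split: if_splits)
    then have "abs_count U m \<le> int m" if "\<forall>m\<le>n. abs_count U' m \<le> int m" "m \<le> n" for m
      using that e[of m] by (cases "m = i") auto
    moreover have "abs_count U' m \<le> abs_count U m" for m by (simp add: e)
    ultimately show ?thesis by (meson order_trans)
  next
    case bar
    have e: "abs_count U' m = abs_count U m + of_bool (m = i)" for m
      using bar by (simp add: abs_count_def)
    have "abs_count U i < int i" if a: "\<forall>m\<le>n. abs_count U m \<le> int m"
      using a[rule_format, of j] a[rule_format, of i] a[rule_format, of "Suc i"] bar Suc(1)[of j] Suc(1)[of i] e
      by (auto simp: j of_bool_def split: if_splits)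
    then have "abs_count U' m \<le> int m" if "\<forall>m\<le>n. abs_count U m \<le> int m" "m \<le> n" for m
      using that by (cases "m = i") (force simp: e)+
    moreover have "abs_count U m \<le> abs_count U' m" for m by (simp add: e)
    ultimately show ?thesis by (meson order_trans)
  next
    case last
    then show ?thesis by (auto simp: abs_count_def)
  qed
  then show ?thesis using col by (simp add: admissible_iff U_def U'_def)
next
  case False
  then show ?thesis using is_column_f_step[OF assms] unfolding admissible_iff by blast
qed

section \<open>Families of inequalities perturbed at one index\<close>

definition bounded :: "nat \<Rightarrow> (nat \<Rightarrow> int) \<Rightarrow> (nat \<Rightarrow> int) \<Rightarrow> (nat \<Rightarrow> int) \<Rightarrow> bool" where
  "bounded n X Y Z \<longleftrightarrow> (\<forall>m k. m \<le> k \<and> k \<le> n \<longrightarrow> Y k \<le> X m \<and> Z k \<le> X m)"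

lemma boundedD:
  assumes "bounded n X Y Z" "m \<le> k" "k \<le> n"
  shows "Y k \<le> X m" "Z k \<le> X m"
  using assms by (auto simp: bounded_def)

lemma bounded_swap: "bounded n X Y Z \<longleftrightarrow> bounded n X Z Y"
  by (auto simp: bounded_def)

lemma bounded_mono:
  assumes "bounded n X Y Z"
    and "\<And>m. m \<le> n \<Longrightarrow> X m \<le> X' m" "\<And>m. m \<le> n \<Longrightarrow> Y' m \<le> Y m" "\<And>m. m \<le> n \<Longrightarrow> Z' m \<le> Z m"
  shows "bounded n X' Y' Z'"
  unfolding bounded_def
proof (intro allI impI conjI; elim conjE)
  fix m k assume mk: "m \<le> k" "k \<le> n"
  show "Y' k \<le> X' m" "Z' k \<le> X' m"
    using boundedD[OF assms(1) mk] assms(2)[of m] assms(3,4)[of k] mk by auto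
qed

text \<open>This lemma and the next three change \<open>X\<close> or \<open>Y\<close> by 1 at the
  single index \<open>i\<close>; the hypothesis \<open>c\<close> supplies the slack for the
  inequalities that get sharper. It has two sources: a neighbouring value of the same function
  already dominates the changed one, or a strict comparison of increments makes a gap such as
  \<open>X - Z\<close> larger at \<open>i\<close> than at \<open>i-1\<close> or \<open>i+1\<close>,
  where it is nonnegative.\<close>

lemma bounded_raise_both:
  assumes b: "bounded n X Y Z" and i: "i = Suc j" "i < n"
    and X: "\<And>m. X' m = X m + of_bool (m = i)" and Y: "\<And>m. Y' m = Y m + of_bool (m = i)"
    and c: "Y i + 1 \<le> Y (Suc i) \<or> Y i + 1 \<le> Y j"
  shows "bounded n X' Y' Z"
  unfolding bounded_def
proof (intro allI impI conjI; elim conjE)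
  fix m k assume mk: "m \<le> k" "k \<le> n"
  have "Y i + 1 \<le> X m" if "m < i"
    using c boundedD(1)[OF b, of m "Suc i"] boundedD(1)[OF b, of m j] that i by auto
  then show "Y' k \<le> X' m" using boundedD(1)[OF b mk] mk by (auto simp: X Y)
  show "Z k \<le> X' m" using boundedD(2)[OF b mk] by (auto simp: X)
qed

lemma bounded_lower_both:
  assumes b: "bounded n X Y Z" and i: "i = Suc j" "i < n"
    and X: "\<And>m. X' m = X m - of_bool (m = i)" and Y: "\<And>m. Y' m = Y m - of_bool (m = i)"
    and c: "X j + 1 \<le> X i \<or>
      (X (Suc i) + 1 \<le> X i \<and> (X (Suc i) - X i < Z (Suc i) - Z i \<or> Z i - Z j < X i - X j))"
  shows "bounded n X' Y' Z"
  unfolding bounded_def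
proof (intro allI impI conjI; elim conjE)
  fix m k assume mk: "m \<le> k" "k \<le> n"
  have "Y k + 1 \<le> X i \<and> Z k + 1 \<le> X i" if "i < k"
    using c boundedD[OF b, of j k] boundedD[OF b, of "Suc i" k] that mk i by auto
  moreover have "Z i + 1 \<le> X i"
    using c boundedD(2)[OF b, of j i] boundedD(2)[OF b, of "Suc i" "Suc i"] boundedD(2)[OF b, of j j] i by auto
  ultimately show "Y' k \<le> X' m" "Z k \<le> X' m"
    using boundedD[OF b mk] mk by (auto simp: X Y le_less)
qed

lemma bounded_raise_lower:
  assumes b: "bounded n X Y Z" and i: "i = Suc j" "i < n"
    and Y: "\<And>m. Y' m = Y m + of_bool (m = i)"
    and c: "Y i + 1 \<le> Y (Suc i) \<or>
      (Y i + 1 \<le> Y j \<and> (X (Suc i) - X i < Y (Suc i) - Y i \<or> Y i - Y j < X i - X j))"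
  shows "bounded n X Y' Z"
  unfolding bounded_def
proof (intro allI impI conjI; elim conjE)
  fix m k assume mk: "m \<le> k" "k \<le> n"
  have "Y i + 1 \<le> X m" if "m < i"
    using c boundedD(1)[OF b, of m "Suc i"] boundedD(1)[OF b, of m j] that i by auto
  moreover have "Y i + 1 \<le> X i"
    using c boundedD(1)[OF b, of i "Suc i"] boundedD(1)[OF b, of "Suc i" "Suc i"] boundedD(1)[OF b, of j j] i by auto
  ultimately show "Y' k \<le> X m" using boundedD(1)[OF b mk] mk by (auto simp: Y le_less)
  show "Z k \<le> X m" using boundedD(2)[OF b mk] .
qed

text \<open>Lowering \<open>X\<close> at \<open>n\<close> affects only \<open>m = k = n\<close>,
  where both lower functions agree, so one strict gap suffices.\<close>

lemma bounded_lower_last: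
  assumes b: "bounded n X Y Z" and i: "n = Suc j"
    and X: "\<And>m. m \<le> n \<Longrightarrow> X' m = X m - of_bool (m = n)" and e: "Y n = Z n"
    and c: "X j + 1 \<le> X n \<or> Y n - Y j < X n - X j \<or> Z n - Z j < X n - X j"
  shows "bounded n X' Y Z"
  unfolding bounded_def
proof (intro allI impI conjI; elim conjE)
  fix m k assume mk: "m \<le> k" "k \<le> n"
  have "Y n + 1 \<le> X n"
    using c boundedD[OF b, of j n] boundedD[OF b, of j j] i e by auto
  then show "Y k \<le> X' m" "Z k \<le> X' m"
    using boundedD[OF b mk] mk e by (auto simp: X)
qed

text \<open>By \<open>excess_le_pending\<close> and \<open>pending_attained\<close> below, the number of pairs \<open>(x, y)\<close> of the
  splitting with \<open>y \<le> m < x\<close> is the maximum of \<open>excess k - excess m\<close> over \<open>m \<le> k \<le> n\<close>. Substituting this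
  into the row comparison of \<open>rV\<close> and \<open>lU\<close> removes the splitting from \<open>V \<preceq> U\<close> and leaves the
  inequalities \<open>fits\<close>.\<close>

definition mixed :: "column \<Rightarrow> column \<Rightarrow> nat \<Rightarrow> int" where
  "mixed U V m = unb_count V m + bar_count U m - int m"

definition excess :: "column \<Rightarrow> nat \<Rightarrow> int" where
  "excess U m = abs_count U m - int m"

text \<open>Readings list the right column first, so \<open>U\<close> is the left factor of the word
  \<open>U @ V\<close> and the right column of the tableau. The shift by the height difference
  arises because barred letters are counted from the bottom of each column.\<close>

definition fits :: "nat \<Rightarrow> column \<Rightarrow> column \<Rightarrow> bool" where
  "fits n U V \<longleftrightarrow>
     bounded n (mixed U V) (excess U) (\<lambda>k. excess V k + (int (length U) - int (length V)))"

text \<open>The step changes counts of \<open>U\<close> at \<open>m = i\<close> only. The signs to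
  the right of the changed letter in \<open>U\<close> pass into \<open>V\<close> as its initial
  credit, and what \<open>nominus\<close> then says about \<open>V\<close> at \<open>i\<close> and
  \<open>i+1\<close> yields the slack condition of the \<open>bounded\<close> lemmas.\<close>

lemma fits_f_step_left:
  assumes st: "f_step n i xs x (ys @ V)" "1 \<le> i" "i \<le> n"
    and U: "U = xs @ x # ys" "U' = xs @ f_letter n i x # ys"
    and col: "is_column n U" "is_column n V"
  shows "fits n U V \<longleftrightarrow> fits n U' V"
proof -
  have st': "f_step n i xs x ys" and nmV: "nominus (sign_at n i) (sign_sum n i ys) V"
    using st(1) by (auto simp: f_step_def nominus_append)
  have col': "is_column n U'" using is_column_f_step[OF st' st(2,3)] col(1) U by simp
  obtain j where j: "i = Suc j" using st(2) by (cases i) auto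
  have len: "length U' = length U" by (simp add: U)
  note dist = col[THEN is_column_distinct] col'[THEN is_column_distinct]
  note Suc = unb_count_Suc[OF dist(1)] bar_count_Suc[OF dist(1)]
    unb_count_Suc[OF dist(2)] bar_count_Suc[OF dist(2)]
    unb_count_Suc[OF dist(3)] bar_count_Suc[OF dist(3)]
  have sV: "sorted_wrt (<) V" using col(2) by (simp add: is_column_def)
  define Z where "Z = (\<lambda>k. excess V k + (int (length U) - int (length V)))"
  have fits: "fits n U V \<longleftrightarrow> bounded n (mixed U V) (excess U) Z"
    "fits n U' V \<longleftrightarrow> bounded n (mixed U' V) (excess U') Z"
    by (simp_all add: fits_def Z_def len)
  have inc: "W \<in> {U, U'} \<Longrightarrow> mixed W V (Suc m) = mixed W V m + of_bool (Unb (Suc m) \<in> set V) + of_bool (Bar (Suc m) \<in> set W) - 1"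
    "W \<in> {U, U', V} \<Longrightarrow> excess W (Suc m) = excess W m + of_bool (Unb (Suc m) \<in> set W) + of_bool (Bar (Suc m) \<in> set W) - 1"
    "Z (Suc m) = Z m + of_bool (Unb (Suc m) \<in> set V) + of_bool (Bar (Suc m) \<in> set V) - 1"
    for W m
    by (auto simp: mixed_def excess_def abs_count_def Z_def Suc)
  show ?thesis
    using st' st(3) U col(1) col'
  proof (cases rule: column_f_step_cases)
    case unb
    have X: "mixed U' V = mixed U V" and Y: "\<And>m. excess U' m = excess U m - of_bool (m = i)"
      using unb by (auto simp: mixed_def excess_def abs_count_def fun_eq_iff)
    \<comment> \<open>A letter \<open>i+1\<close> of \<open>V\<close> without \<open>i\<close>
      beside it is a minus that only the barred \<open>i+1\<close> of \<open>U\<close> can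
      absorb.\<close>
    have V: "Bar (Suc i) \<in> set U \<or> Unb (Suc i) \<notin> set V \<or> Unb i \<in> set V"
      using nominus_column(1)[OF sV nmV unb(1)] unb(8,9) by (auto simp: of_bool_def split: if_splits)
    show ?thesis unfolding fits X
    proof
      assume "bounded n (mixed U V) (excess U) Z"
      then show "bounded n (mixed U V) (excess U') Z" by (rule bounded_mono) (auto simp: Y)
    next
      assume b: "bounded n (mixed U V) (excess U') Z"
      show "bounded n (mixed U V) (excess U) Z"
        using unb V inc(1)[of U j] inc(1)[of U i] inc(2)[of U' j] inc(2)[of U' i]
        by (intro bounded_raise_lower[OF b j unb(1)])
          (auto simp: Y j of_bool_def split: if_splits)
    qed
  next
    case bar
    have X: "\<And>m. mixed U' V m = mixed U V m + of_bool (m = i)"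
      and Y: "\<And>m. excess U' m = excess U m + of_bool (m = i)"
      using bar by (auto simp: mixed_def excess_def abs_count_def)
    have V: "Unb (Suc i) \<in> set V \<longrightarrow> Unb i \<in> set V"
      "Bar i \<in> set V \<longrightarrow> Bar (Suc i) \<in> set V \<or> (Unb i \<in> set V \<and> Unb (Suc i) \<notin> set V)"
      using nominus_column(1,2)[OF sV nmV bar(1)] bar(8) by (auto simp: of_bool_def split: if_splits)
    show ?thesis unfolding fits
    proof
      assume b: "bounded n (mixed U V) (excess U) Z"
      show "bounded n (mixed U' V) (excess U') Z"
        using bar inc(2)[of U j] inc(2)[of U i]
        by (intro bounded_raise_both[OF b j bar(1) X Y])
          (auto simp: j of_bool_def split: if_splits)
    next
      assume b: "bounded n (mixed U' V) (excess U') Z"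
      show "bounded n (mixed U V) (excess U) Z"
        using bar V inc(1)[of U' j] inc(1)[of U' i] inc(3)[of j] inc(3)[of i]
        by (intro bounded_lower_both[OF b j bar(1)])
          (auto simp: X Y j of_bool_def split: if_splits)
    qed
  next
    case last
    have X: "\<And>m. m \<le> n \<Longrightarrow> mixed U' V m = mixed U V m + of_bool (m = n)"
      and Y: "\<And>m. m \<le> n \<Longrightarrow> excess U' m = excess U m"
      using last by (auto simp: mixed_def excess_def abs_count_def)
    have V: "Bar n \<in> set V \<longrightarrow> Unb n \<in> set V"
      using nominus_column(3)[OF sV nmV last(1)] last(7) by (auto simp: of_bool_def split: if_splits)
    \<comment> \<open>At \<open>k = n\<close> all letters are counted, and both lower functions
      equal the height of \<open>U\<close> minus \<open>n\<close>.\<close>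
    have e: "excess U' n = Z n"
      using abs_count_eq_length[OF col'] abs_count_eq_length[OF col(2)] len by (simp add: excess_def Z_def)
    have nj: "n = Suc j" using j last(1) by simp
    show ?thesis unfolding fits
    proof
      assume "bounded n (mixed U V) (excess U) Z"
      then show "bounded n (mixed U' V) (excess U') Z" by (rule bounded_mono) (auto simp: X Y)
    next
      assume b: "bounded n (mixed U' V) (excess U') Z"
      have "bounded n (mixed U V) (excess U') Z"
        using last V inc(1)[of U' j] inc(3)[of j]
        by (intro bounded_lower_last[OF b nj _ e]) (auto simp: X nj of_bool_def split: if_splits)
      then show "bounded n (mixed U V) (excess U) Z" by (rule bounded_mono) (auto simp: Y)
    qed
  qed
qed

text \<open>Mirror image: the signs of \<open>xs\<close>, to the left of the changed letter in
  \<open>V\<close>, now constrain the pluses of \<open>U\<close>.\<close>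

lemma fits_f_step_right:
  assumes st: "f_step n i (U @ xs) x ys" "1 \<le> i" "i \<le> n"
    and V: "V = xs @ x # ys" "V' = xs @ f_letter n i x # ys"
    and col: "is_column n U" "is_column n V"
  shows "fits n U V \<longleftrightarrow> fits n U V'"
proof -
  have st': "f_step n i xs x ys" and npU: "noplus (sign_at n i) (sign_sum n i xs) U"
    using st(1) by (auto simp: f_step_def noplus_append)
  have col': "is_column n V'" using is_column_f_step[OF st' st(2,3)] col(2) V by simp
  obtain j where j: "i = Suc j" using st(2) by (cases i) auto
  have len: "length V' = length V" by (simp add: V)
  note dist = col[THEN is_column_distinct] col'[THEN is_column_distinct]
  note Suc = unb_count_Suc[OF dist(1)] bar_count_Suc[OF dist(1)]
    unb_count_Suc[OF dist(2)] bar_count_Suc[OF dist(2)]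
    unb_count_Suc[OF dist(3)] bar_count_Suc[OF dist(3)]
  have sU: "sorted_wrt (<) U" using col(1) by (simp add: is_column_def)
  define Z where "Z = (\<lambda>W k. excess W k + (int (length U) - int (length V)))"
  \<comment> \<open>The two lower functions trade places, so that the one that changes is again the
    \<open>Y\<close> of the \<open>bounded\<close> lemmas.\<close>
  have fits: "fits n U V \<longleftrightarrow> bounded n (mixed U V) (Z V) (excess U)"
    "fits n U V' \<longleftrightarrow> bounded n (mixed U V') (Z V') (excess U)"
    by (simp_all add: fits_def Z_def len bounded_swap)
  have inc: "W \<in> {V, V'} \<Longrightarrow> mixed U W (Suc m) = mixed U W m + of_bool (Unb (Suc m) \<in> set W) + of_bool (Bar (Suc m) \<in> set U) - 1"
    "excess U (Suc m) = excess U m + of_bool (Unb (Suc m) \<in> set U) + of_bool (Bar (Suc m) \<in> set U) - 1"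
    "W \<in> {V, V'} \<Longrightarrow> Z W (Suc m) = Z W m + of_bool (Unb (Suc m) \<in> set W) + of_bool (Bar (Suc m) \<in> set W) - 1"
    for W m
    by (auto simp: mixed_def excess_def abs_count_def Z_def Suc)
  show ?thesis
    using st' st(3) V col(2) col'
  proof (cases rule: column_f_step_cases)
    case unb
    have X: "\<And>m. mixed U V' m = mixed U V m - of_bool (m = i)"
      and Z: "\<And>m. Z V' m = Z V m - of_bool (m = i)"
      using unb by (auto simp: mixed_def excess_def abs_count_def Z_def)
    have U: "Bar (Suc i) \<in> set U \<longrightarrow> Bar i \<in> set U"
      "Unb i \<in> set U \<longrightarrow> Unb (Suc i) \<in> set U \<or> (Bar i \<in> set U \<and> Bar (Suc i) \<notin> set U)"
      using noplus_column(1,2)[OF sU npU unb(1)] unb(7) by (auto simp: of_bool_def split: if_splits)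
    show ?thesis unfolding fits
    proof
      assume b: "bounded n (mixed U V) (Z V) (excess U)"
      show "bounded n (mixed U V') (Z V') (excess U)"
        using unb U inc(1)[of V j] inc(1)[of V i] inc(2)[of j] inc(2)[of i]
        by (intro bounded_lower_both[OF b j unb(1) X Z])
          (auto simp: j of_bool_def split: if_splits)
    next
      assume b: "bounded n (mixed U V') (Z V') (excess U)"
      show "bounded n (mixed U V) (Z V) (excess U)"
        using unb inc(3)[of V' j] inc(3)[of V' i]
        by (intro bounded_raise_both[OF b j unb(1)])
          (auto simp: X Z j of_bool_def split: if_splits)
    qed
  next
    case bar
    have X: "mixed U V' = mixed U V" and Z: "\<And>m. Z V' m = Z V m + of_bool (m = i)"
      using bar by (auto simp: mixed_def excess_def abs_count_def Z_def fun_eq_iff)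
    have U: "Unb (Suc i) \<in> set V \<or> (Bar (Suc i) \<in> set U \<longrightarrow> Bar i \<in> set U)"
      using noplus_column(1)[OF sU npU bar(1)] bar(7,9) by (auto simp: of_bool_def split: if_splits)
    show ?thesis unfolding fits X
    proof
      assume b: "bounded n (mixed U V) (Z V) (excess U)"
      show "bounded n (mixed U V) (Z V') (excess U)"
        using bar U inc(1)[of V j] inc(1)[of V i] inc(3)[of V j] inc(3)[of V i]
        by (intro bounded_raise_lower[OF b j bar(1) Z])
          (auto simp: j of_bool_def split: if_splits)
    next
      assume "bounded n (mixed U V) (Z V') (excess U)"
      then show "bounded n (mixed U V) (Z V) (excess U)" by (rule bounded_mono) (auto simp: Z)
    qed
  next
    case last
    have X: "\<And>m. m \<le> n \<Longrightarrow> mixed U V' m = mixed U V m - of_bool (m = n)"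
      and Z: "\<And>m. m \<le> n \<Longrightarrow> Z V' m = Z V m"
      using last by (auto simp: mixed_def excess_def abs_count_def Z_def)
    have U: "Unb n \<in> set U \<longrightarrow> Bar n \<in> set U"
      using noplus_column(3)[OF sU npU last(1)] last(6) by (auto simp: of_bool_def split: if_splits)
    have e: "Z V n = excess U n"
      using abs_count_eq_length[OF col(1)] abs_count_eq_length[OF col(2)] by (simp add: excess_def Z_def)
    have nj: "n = Suc j" using j last(1) by simp
    show ?thesis unfolding fits
    proof
      assume b: "bounded n (mixed U V) (Z V) (excess U)"
      have "bounded n (mixed U V') (Z V) (excess U)"
        using last U inc(1)[of V j] inc(2)[of j]
        by (intro bounded_lower_last[OF b nj X e]) (auto simp: nj of_bool_def split: if_splits)
      then show "bounded n (mixed U V') (Z V') (excess U)" by (rule bounded_mono) (auto simp: Z)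
    next
      assume "bounded n (mixed U V') (Z V') (excess U)"
      then show "bounded n (mixed U V) (Z V) (excess U)" by (rule bounded_mono) (auto simp: X Z)
    qed
  qed
qed

section \<open>Splitting an admissible column\<close>

definition doubles :: "column \<Rightarrow> nat set" where
  "doubles U = {x. Unb x \<in> set U \<and> Bar x \<in> set U}"

definition holes :: "column \<Rightarrow> nat set" where
  "holes U = {x. 1 \<le> x \<and> Unb x \<notin> set U \<and> Bar x \<notin> set U}"

lemma finite_doubles: "finite (doubles U)"
proof -
  have "Unb ` doubles U \<subseteq> set U" by (auto simp: doubles_def)
  then show ?thesis
    by (metis List.finite_set finite_imageD finite_subset inj_on_def letter.inject(1))
qed

lemma doubles_holes: "x \<in> doubles U \<Longrightarrow> x \<notin> holes U"
  by (auto simp: doubles_def holes_def)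

lemma doubles_range: "is_column n U \<Longrightarrow> x \<in> doubles U \<Longrightarrow> 1 \<le> x \<and> x \<le> n"
  by (auto simp: is_column_def alphabet_def doubles_def)

text \<open>Passing from \<open>k\<close> to \<open>k+1\<close>, \<open>N\<close> grows by 2 at a
  doubled index, by 0 at a hole and by 1 otherwise, so \<open>excess\<close> is a walk with steps 1,
  -1 and 0.\<close>

lemma excess_diff:
  assumes "distinct U" "m \<le> k"
  shows "excess U k - excess U m =
    int (card {x \<in> doubles U. m < x \<and> x \<le> k}) - int (card {h \<in> holes U. m < h \<and> h \<le> k})"
  using assms(2)
proof (induction k rule: dec_induct)
  case base
  have *: "{x \<in> A. m < x \<and> x \<le> m} = {}" for A by auto
  show ?case unfolding * by simp
next
  case (step k)
  have *: "card {x \<in> A. m < x \<and> x \<le> Suc k} = card {x \<in> A. m < x \<and> x \<le> k} + of_bool (Suc k \<in> A)" for A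
  proof -
    have "{x \<in> A. m < x \<and> x \<le> Suc k} =
        (if Suc k \<in> A then insert (Suc k) {x \<in> A. m < x \<and> x \<le> k} else {x \<in> A. m < x \<and> x \<le> k})"
      using step.hyps by (auto simp: le_Suc_eq)
    then show ?thesis by (auto simp: card_insert_if)
  qed
  have "excess U (Suc k) = excess U k + of_bool (Suc k \<in> doubles U) - of_bool (Suc k \<in> holes U)"
    using abs_count_Suc[OF assms(1), of k] by (auto simp: excess_def doubles_def holes_def)
  then show ?case using step.IH * by simp
qed

text \<open>The cardinality hypotheses keep every maximum in \<open>split_from\<close> over a
  nonempty set: each choice uses up one hole, and enough remain below it. The last clause records
  greediness: a hole skipped between a target and its letter is itself a target or is excluded by
  the bound \<open>b\<close>.\<close>

lemma split_from_props:
  assumes "sorted_wrt (>) xs"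
    and "length xs \<le> card {h \<in> holes U. h < b}"
    and "\<And>j. j < length xs \<Longrightarrow> length xs - j \<le> card {h \<in> holes U. h < xs ! j}"
  shows "length (split_from U b xs) = length xs \<and> sorted_wrt (>) (split_from U b xs) \<and>
    (\<forall>y\<in>set (split_from U b xs). y \<in> holes U \<and> y < b) \<and>
    (\<forall>j<length xs. split_from U b xs ! j < xs ! j) \<and>
    (\<forall>j<length xs. \<forall>h\<in>holes U. split_from U b xs ! j < h \<and> h < xs ! j \<longrightarrow>
       h \<in> set (split_from U b xs) \<or> b \<le> h)"
  using assms
proof (induction xs arbitrary: b)
  case (Cons x xs)
  define S where "S = {h \<in> holes U. h < min b x}"
  define y where "y = Max S"
  have split: "split_from U b (x # xs) = y # split_from U y xs"
    by (simp add: Let_def y_def S_def holes_def conj_ac)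
  have "Suc (length xs) \<le> card S"
    using Cons.prems(2) Cons.prems(3)[of 0] by (cases "b \<le> x") (auto simp: S_def min_def)
  moreover have "finite S" by (auto simp: S_def)
  ultimately have S: "S \<noteq> {}" "length xs \<le> card (S - {y})"
    by (auto simp: card_Diff_singleton_if)
  have y: "y \<in> S" "\<And>h. h \<in> S \<Longrightarrow> h \<le> y"
    using \<open>finite S\<close> S(1) by (auto simp: y_def)
  have "S - {y} = {h \<in> holes U. h < y}" using y by (fastforce simp: S_def)
  then have 2: "length xs \<le> card {h \<in> holes U. h < y}" using S(2) by simp
  have 3: "length xs - j \<le> card {h \<in> holes U. h < xs ! j}" if "j < length xs" for j
    using Cons.prems(3)[of "Suc j"] that by simp
  define ys where "ys = split_from U y xs"
  have IH: "length ys = length xs" "sorted_wrt (>) ys" "\<And>z. z \<in> set ys \<Longrightarrow> z \<in> holes U \<and> z < y"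
    "\<And>j. j < length xs \<Longrightarrow> ys ! j < xs ! j"
    "\<And>j h. j < length xs \<Longrightarrow> h \<in> holes U \<Longrightarrow> ys ! j < h \<Longrightarrow> h < xs ! j \<Longrightarrow> h \<in> set ys \<or> y \<le> h"
    using Cons.IH[OF _ 2 3] Cons.prems(1) by (auto simp: ys_def)
  have y': "y \<in> holes U" "y < b" "y < x" using y(1) by (auto simp: S_def)
  have gap: "b \<le> h" if "h \<in> holes U" "y < h" "h < x" for h
    using y(2)[of h] that by (force simp: S_def)
  have "h \<in> set (y # ys) \<or> b \<le> h"
    if j: "j < length (x # xs)" and h: "h \<in> holes U" "(y # ys) ! j < h" "h < (x # xs) ! j" for j h
  proof (cases j)
    case 0
    then show ?thesis using gap h by simp
  next
    case (Suc i)
    then have i: "i < length xs" "ys ! i < h" "h < xs ! i" using j h by auto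
    then have "h < x" using Cons.prems(1) by (meson nth_mem order_less_trans sorted_wrt.simps(2))
    then show ?thesis using IH(5)[OF i(1) h(1) i(2,3)] gap[OF h(1)] by (cases "h = y") auto
  qed
  moreover have "(y # ys) ! j < (x # xs) ! j" if "j < length (x # xs)" for j
    using that IH(4) y' by (cases j) auto
  moreover have "\<forall>z\<in>set (y # ys). z \<in> holes U \<and> z < b" using IH(3) y' by fastforce
  moreover have "sorted_wrt (>) (y # ys)" using IH(2,3) by auto
  ultimately show ?case unfolding split ys_def[symmetric] using IH(1) by simp
qed simp

text \<open>Admissibility at \<open>x\<close> says \<open>excess U x \<le> 0\<close>, that is, there
  are at least as many holes as doubled letters up to \<open>x\<close>; this is the supply the
  greedy choice needs.\<close>

lemma split_map_props:
  assumes adm: "admissible n U"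
  shows "\<And>x. x \<notin> doubles U \<Longrightarrow> split_map U x = x"
    and "\<And>x. x \<in> doubles U \<Longrightarrow> split_map U x \<in> holes U \<and> split_map U x < x"
    and "inj_on (split_map U) (doubles U)"
    and "\<And>x h. x \<in> doubles U \<Longrightarrow> h \<in> holes U \<Longrightarrow> split_map U x < h \<Longrightarrow> h < x \<Longrightarrow>
           h \<in> split_map U ` doubles U"
proof -
  have col: "is_column n U" using adm by (simp add: admissible_iff)
  define xs where "xs = doubled U"
  define ys where "ys = split_targets U"
  have xs: "sorted_wrt (>) xs" "set xs = doubles U"
    using finite_doubles[of U]
    by (auto simp: xs_def doubled_def doubles_def[symmetric] sorted_wrt_rev)
  then have dist: "distinct xs"
    by (metis distinct_rev sorted_wrt_rev strict_sorted_iff rev_rev_ident)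
  have enough: "length xs - j \<le> card {h \<in> holes U. h < xs ! j}" if j: "j < length xs" for j
  proof -
    define x where "x = xs ! j"
    have x: "x \<in> doubles U" using nth_mem[OF j] xs(2) by (simp add: x_def)
    then have x0: "1 \<le> x" "x \<le> n" using doubles_range[OF col] by auto
    have "set (drop j xs) \<subseteq> {z \<in> doubles U. 0 < z \<and> z \<le> x}"
    proof
      fix z assume dz: "z \<in> set (drop j xs)"
      then obtain i where i: "i < length xs - j" "z = xs ! (j + i)" by (auto simp: in_set_conv_nth)
      then have "i = 0 \<or> z < x"
        using sorted_wrt_nth_less[OF xs(1), of j "j + i"] by (cases "i = 0") (auto simp: x_def)
      then have "z \<le> x" using i(2) by (auto simp: x_def)
      moreover have z: "z \<in> doubles U" using in_set_dropD[OF dz] xs(2) by simp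
      moreover have "0 < z" using doubles_range[OF col z] by simp
      ultimately show "z \<in> {z \<in> doubles U. 0 < z \<and> z \<le> x}" by simp
    qed
    then have "card (set (drop j xs)) \<le> card {z \<in> doubles U. 0 < z \<and> z \<le> x}"
      by (intro card_mono) (use finite_doubles in auto)
    then have "length xs - j \<le> card {z \<in> doubles U. 0 < z \<and> z \<le> x}"
      using dist by (simp add: distinct_card)
    moreover have "excess U x \<le> 0" "excess U 0 = 0"
      using adm x0 counts_0[OF col] by (auto simp: admissible_iff excess_def)
    then have "card {z \<in> doubles U. 0 < z \<and> z \<le> x} \<le> card {h \<in> holes U. 0 < h \<and> h \<le> x}"
      using excess_diff[OF is_column_distinct[OF col], of 0 x] by simp
    moreover have "{h \<in> holes U. 0 < h \<and> h \<le> x} = {h \<in> holes U. h < x}"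
      using doubles_holes[OF x] by (auto simp: holes_def le_less)
    ultimately show ?thesis by (simp add: x_def)
  qed
  have ys: "length ys = length xs" "sorted_wrt (>) ys" "\<And>y. y \<in> set ys \<Longrightarrow> y \<in> holes U"
    "\<And>j. j < length xs \<Longrightarrow> ys ! j < xs ! j"
    "\<And>j h. j < length xs \<Longrightarrow> h \<in> holes U \<Longrightarrow> ys ! j < h \<Longrightarrow> h < xs ! j \<Longrightarrow> h \<in> set ys"
  proof -
    \<comment> \<open>For an empty list the value \<open>hd xs\<close> is unspecified, but the left
      side is then 0.\<close>
    have hd: "length xs \<le> card {h \<in> holes U. h < hd xs}"
      using enough[of 0] by (cases xs) auto
    have le: "h < hd xs" if "j < length xs" "h < xs ! j" for j h
      using that sorted_wrt_nth_less[OF xs(1), of 0 j] by (cases "j = 0"; cases xs) auto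
    note p = split_from_props[OF xs(1) hd enough]
    have ys_eq: "ys = split_from U (hd xs) xs" by (simp add: ys_def split_targets_def xs_def)
    show "length ys = length xs" "sorted_wrt (>) ys" "\<And>y. y \<in> set ys \<Longrightarrow> y \<in> holes U"
      "\<And>j. j < length xs \<Longrightarrow> ys ! j < xs ! j"
      using p by (auto simp: ys_eq)
    show "h \<in> set ys" if "j < length xs" "h \<in> holes U" "ys ! j < h" "h < xs ! j" for j h
      using p that le[OF that(1,4)] by (fastforce simp: ys_eq)
  qed
  have nth: "split_map U (xs ! j) = ys ! j" if "j < length xs" for j
    using map_of_zip_nth[OF ys(1)[symmetric] dist, of j] ys(1) that
    by (simp add: split_map_def xs_def[symmetric] ys_def[symmetric])
  have img: "split_map U ` doubles U = set ys"
    unfolding xs(2)[symmetric] using nth ys(1) by (force simp: in_set_conv_nth image_iff)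
  show "split_map U x = x" if "x \<notin> doubles U" for x
  proof -
    have "map_of (zip xs ys) x = None"
      using that xs(2) ys(1) by (simp add: map_of_zip_is_None)
    then show ?thesis by (simp add: split_map_def xs_def ys_def)
  qed
  show "split_map U x \<in> holes U \<and> split_map U x < x" if "x \<in> doubles U" for x
    using that nth ys(1,3,4) unfolding xs(2)[symmetric] by (metis in_set_conv_nth nth_mem)
  have "card (split_map U ` doubles U) = card (doubles U)"
  proof -
    have "distinct ys" using ys(2) by (metis distinct_rev sorted_wrt_rev strict_sorted_iff rev_rev_ident)
    then show ?thesis
      using distinct_card[of ys] distinct_card[OF dist] ys(1) unfolding img by (simp add: xs(2))
  qed
  then show "inj_on (split_map U) (doubles U)" by (rule eq_card_imp_inj_on[OF finite_doubles])
  show "h \<in> split_map U ` doubles U"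
    if x: "x \<in> doubles U" and h: "h \<in> holes U" "split_map U x < h" "h < x" for x h
  proof -
    obtain j where j: "j < length xs" "x = xs ! j" using x xs(2) by (metis in_set_conv_nth)
    then show ?thesis using ys(5)[OF j(1) h(1)] h(2,3) nth[OF j(1)] by (simp add: img)
  qed
qed

definition pending :: "column \<Rightarrow> nat \<Rightarrow> int" where
  "pending U m = int (card {x \<in> doubles U. split_map U x \<le> m \<and> m < x})"

text \<open>A doubled letter in \<open>(m, k]\<close> either has its target at most
  \<open>m\<close>, and is then pending at \<open>m\<close>, or has it in \<open>(m, k]\<close>. The
  targets of the second kind inject into the holes there.\<close>

lemma excess_le_pending:
  assumes adm: "admissible n U" and "m \<le> k"
  shows "excess U k \<le> excess U m + pending U m"
proof -
  note sp = split_map_props[OF adm]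
  have d: "distinct U" using adm is_column_distinct by (auto simp: admissible_iff)
  define A where "A = {x \<in> doubles U. split_map U x \<le> m \<and> m < x}"
  define B where "B = {x \<in> doubles U. m < x \<and> x \<le> k \<and> m < split_map U x}"
  define H where "H = {h \<in> holes U. m < h \<and> h \<le> k}"
  have fin: "finite A" "finite B" "finite H"
    using finite_doubles[of U] by (auto simp: A_def B_def H_def)
  have "split_map U ` B \<subseteq> H" using sp(2) by (fastforce simp: B_def H_def)
  moreover have "inj_on (split_map U) B" using sp(3) by (rule inj_on_subset) (auto simp: B_def)
  ultimately have "card B \<le> card H" using fin by (metis card_inj_on_le)
  moreover have "card {x \<in> doubles U. m < x \<and> x \<le> k} \<le> card (A \<union> B)"
    using fin by (intro card_mono) (auto simp: A_def B_def)
  ultimately have "card {x \<in> doubles U. m < x \<and> x \<le> k} \<le> card A + card H"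
    using card_Un_le[of A B] by linarith
  then show ?thesis using excess_diff[OF d assms(2)] by (simp add: pending_def A_def H_def)
qed

text \<open>The witness is \<open>k = h - 1\<close> for the least hole \<open>h > m\<close> that is not a split target (\<open>k = n\<close> if there
  is none): by maximality of the targets, no pair of the splitting straddles \<open>h\<close>.\<close>

lemma pending_attained:
  assumes adm: "admissible n U" and "m \<le> n"
  shows "\<exists>k. m \<le> k \<and> k \<le> n \<and> excess U k = excess U m + pending U m"
proof -
  note sp = split_map_props[OF adm]
  have d: "distinct U" and col: "is_column n U"
    using adm is_column_distinct by (auto simp: admissible_iff)
  define free where "free h \<longleftrightarrow> h \<in> holes U \<and> h \<notin> split_map U ` doubles U \<and> m < h" for h
  obtain k where k: "m \<le> k" "k \<le> n" "\<And>h. m < h \<Longrightarrow> h \<le> k \<Longrightarrow> \<not> free h" "k = n \<or> free (Suc k)"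
  proof (cases "\<exists>h\<le>n. free h")
    case True
    define h where "h = (LEAST h. free h)"
    have h: "free h" "\<And>h'. free h' \<Longrightarrow> h \<le> h'"
      using True unfolding h_def by (auto intro: LeastI Least_le)
    moreover have "h \<le> n" using True h(2) order_trans by blast
    moreover have "m < h" using h(1) by (simp add: free_def)
    ultimately show ?thesis
      by (intro that[of "h - 1"]) (force simp: Suc_diff_Suc)+
  next
    case False
    then show ?thesis using assms(2) by (intro that[of n]) auto
  qed
  have le_n: "x \<le> n" if "x \<in> doubles U" for x
    using doubles_range[OF col that] by simp
  have cross: "x \<le> k" if x: "x \<in> doubles U" "split_map U x \<le> k" for x
  proof (rule ccontr)
    assume "\<not> x \<le> k"
    then have "free (Suc k)" using k(4) le_n[OF x(1)] by auto
    moreover from this have "Suc k < x"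
      using \<open>\<not> x \<le> k\<close> doubles_holes[OF x(1)] by (auto simp: free_def not_le intro: Suc_lessI)
    ultimately show False using sp(4)[OF x(1), of "Suc k"] x(2) by (auto simp: free_def)
  qed
  define A where "A = {x \<in> doubles U. split_map U x \<le> m \<and> m < x}"
  define B where "B = {x \<in> doubles U. m < x \<and> x \<le> k \<and> m < split_map U x}"
  define H where "H = {h \<in> holes U. m < h \<and> h \<le> k}"
  have fin: "finite A" "finite B"
    using finite_doubles[of U] by (auto simp: A_def B_def)
  have "split_map U ` B = H"
  proof
    show "split_map U ` B \<subseteq> H" using sp(2) by (fastforce simp: B_def H_def)
    show "H \<subseteq> split_map U ` B"
    proof
      fix h assume h: "h \<in> H"
      then obtain x where x: "x \<in> doubles U" "h = split_map U x"
        using k(3)[of h] by (auto simp: H_def free_def)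
      moreover have "x \<le> k" "m < x" using cross[OF x(1)] sp(2)[OF x(1)] h x(2) by (auto simp: H_def)
      ultimately show "h \<in> split_map U ` B" using h by (auto simp: B_def H_def)
    qed
  qed
  moreover have "inj_on (split_map U) B" using sp(3) by (rule inj_on_subset) (auto simp: B_def)
  ultimately have "card H = card B" using card_image by blast
  moreover have "{x \<in> doubles U. m < x \<and> x \<le> k} = A \<union> B"
    using cross k(1) by (fastforce simp: A_def B_def)
  moreover have "card (A \<union> B) = card A + card B"
    using fin by (intro card_Un_disjoint) (auto simp: A_def B_def)
  ultimately have "excess U k = excess U m + pending U m"
    using excess_diff[OF d k(1)] by (simp add: pending_def A_def H_def)
  then show ?thesis using k by blast
qed

section \<open>Row comparison by counting entries\<close>

lemma sorted_count_nth:
  assumes "sorted (c::'a::linorder list)"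
  shows "k < length (filter (\<lambda>x. x \<le> a) c) \<longleftrightarrow> k < length c \<and> c ! k \<le> a"
  using assms
proof (induction c arbitrary: k)
  case (Cons x c)
  show ?case
  proof (cases "x \<le> a")
    case True
    then show ?thesis using Cons by (cases k) auto
  next
    case False
    then have "\<forall>y\<in>set (x # c). \<not> y \<le> a" using Cons.prems by fastforce
    then have "filter (\<lambda>x. x \<le> a) (x # c) = []" "k < length (x # c) \<Longrightarrow> \<not> (x # c) ! k \<le> a"
      using nth_mem[of k "x # c"] by (auto simp: filter_empty_conv simp del: filter.simps nth_Cons_Suc)
    then show ?thesis by (auto simp del: filter.simps)
  qed
qed simp

lemma letter_le_Bar_0: "(x::letter) \<le> Bar 0"
  by (cases x) auto

lemma col_le_iff_counts:
  assumes "sorted c" "sorted d"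
  shows "col_le c d \<longleftrightarrow>
    (\<forall>a. length (filter (\<lambda>x. x \<le> a) d) \<le> length (filter (\<lambda>x. x \<le> a) c))"
proof
  assume le: "col_le c d"
  show "\<forall>a. length (filter (\<lambda>x. x \<le> a) d) \<le> length (filter (\<lambda>x. x \<le> a) c)"
  proof (rule allI, rule ccontr)
    fix a assume "\<not> length (filter (\<lambda>x. x \<le> a) d) \<le> length (filter (\<lambda>x. x \<le> a) c)"
    then show False
      using sorted_count_nth[OF assms(1), of "length (filter (\<lambda>x. x \<le> a) c)" a]
        sorted_count_nth[OF assms(2), of "length (filter (\<lambda>x. x \<le> a) c)" a] le
      by (force simp: col_le_def)
  qed
next
  assume le: "\<forall>a. length (filter (\<lambda>x. x \<le> a) d) \<le> length (filter (\<lambda>x. x \<le> a) c)"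
  have "filter (\<lambda>x. x \<le> Bar 0) e = e" for e
    by (simp add: letter_le_Bar_0)
  \<comment> \<open>\<open>Bar 0\<close> is the largest letter of the type, so this cutoff counts
    whole columns.\<close>
  then have "length d \<le> length c" using le[rule_format, of "Bar 0"] by simp
  moreover have "c ! k \<le> d ! k" if "k < length d" for k
    using sorted_count_nth[OF assms(1), of k "d ! k"] sorted_count_nth[OF assms(2), of k "d ! k"]
      le[rule_format, of "d ! k"] that by simp
  ultimately show "col_le c d" by (simp add: col_le_def)
qed

lemma length_filter_sort: "length (filter P (sort xs)) = length (filter P xs)"
  by (simp add: filter_sort)

lemma length_filter_distinct: "distinct xs \<Longrightarrow> length (filter P xs) = card {x \<in> set xs. P x}"
  by (metis distinct_card distinct_filter set_filter)

lemma pending_disjoint_union: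
  assumes "inj C" "finite A" "\<And>x. x \<in> {x \<in> doubles U. split_map U x \<le> m \<and> m < x} \<Longrightarrow> C x \<notin> A"
  shows "int (card (A \<union> C ` {x \<in> doubles U. split_map U x \<le> m \<and> m < x})) = int (card A) + pending U m"
proof -
  have "card (A \<union> C ` {x \<in> doubles U. split_map U x \<le> m \<and> m < x}) =
      card A + card (C ` {x \<in> doubles U. split_map U x \<le> m \<and> m < x})"
    using assms finite_doubles[of U] by (intro card_Un_disjoint) auto
  then show ?thesis using card_image[OF inj_on_subset[OF assms(1)]] by (simp add: pending_def)
qed

text \<open>Replacing \<open>x\<close> by the smaller \<open>y\<close> adds an entry at most
  \<open>Unb m\<close> for each pair with \<open>y \<le> m < x\<close>; barred entries stay.\<close>

lemma left_col_counts:
  assumes adm: "admissible n U"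
  shows "int (length (filter (\<lambda>x. x \<le> Unb m) (left_col U))) = unb_count U m + pending U m"
    and "int (length (filter (\<lambda>x. x \<le> Bar (Suc m)) (left_col U))) = int (length U) - bar_count U m"
    and "length (filter (\<lambda>x. x \<le> Bar 0) (left_col U)) = length U"
proof -
  note sp = split_map_props[OF adm]
  have d: "distinct U" using adm is_column_distinct by (auto simp: admissible_iff)
  define g where "g = (\<lambda>c. case c of Unb x \<Rightarrow> Unb (split_map U x) | Bar x \<Rightarrow> Bar x)"
  have cnt: "length (filter P (left_col U)) = length (filter (\<lambda>c. P (g c)) U)" for P
    by (simp add: left_col_def g_def[symmetric] length_filter_sort filter_map o_def)
  have le: "split_map U x \<le> m \<longleftrightarrow> x \<le> m \<or> (x \<in> doubles U \<and> split_map U x \<le> m \<and> m < x)" for x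
    using sp(1,2)[of x] by (cases "x \<in> doubles U") auto
  have "{c \<in> set U. g c \<le> Unb m} =
      {c \<in> set U. c \<le> Unb m} \<union> Unb ` {x \<in> doubles U. split_map U x \<le> m \<and> m < x}"
  proof (rule set_eqI)
    fix c
    show "c \<in> {c \<in> set U. g c \<le> Unb m} \<longleftrightarrow>
        c \<in> {c \<in> set U. c \<le> Unb m} \<union> Unb ` {x \<in> doubles U. split_map U x \<le> m \<and> m < x}"
      using le by (cases c) (auto simp: g_def doubles_def)
  qed
  then show "int (length (filter (\<lambda>x. x \<le> Unb m) (left_col U))) = unb_count U m + pending U m"
    unfolding cnt unb_count_def length_filter_distinct[OF d]
    by (subst pending_disjoint_union[symmetric, of Unb]) (auto simp: inj_def)
  \<comment> \<open>The shift of index arises because the letters not at most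
    \<open>Bar (Suc m)\<close> are those at least \<open>Bar m\<close>.\<close>
  have "filter (\<lambda>c. g c \<le> Bar (Suc m)) U = filter (\<lambda>c. \<not> Bar m \<le> c) U"
    by (intro filter_cong) (auto simp: g_def split: letter.splits)
  then show "int (length (filter (\<lambda>x. x \<le> Bar (Suc m)) (left_col U))) = int (length U) - bar_count U m"
    unfolding cnt bar_count_def using sum_length_filter_compl[of "\<lambda>c. Bar m \<le> c" U] by simp
  show "length (filter (\<lambda>x. x \<le> Bar 0) (left_col U)) = length U"
    unfolding cnt by (simp add: letter_le_Bar_0)
qed

text \<open>Here the barred entries move: \<open>Bar y\<close> is larger than \<open>Bar x\<close>,
  so every pair with \<open>y \<le> m < x\<close> leaves the part at most
  \<open>Bar (Suc m)\<close>.\<close>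

lemma right_col_counts:
  assumes adm: "admissible n U"
  shows "int (length (filter (\<lambda>x. x \<le> Unb m) (right_col U))) = unb_count U m"
    and "int (length (filter (\<lambda>x. x \<le> Bar (Suc m)) (right_col U))) =
           int (length U) - bar_count U m - pending U m"
    and "length (filter (\<lambda>x. x \<le> Bar 0) (right_col U)) = length U"
proof -
  note sp = split_map_props[OF adm]
  have d: "distinct U" using adm is_column_distinct by (auto simp: admissible_iff)
  define g where "g = (\<lambda>c. case c of Unb x \<Rightarrow> Unb x | Bar x \<Rightarrow> Bar (split_map U x))"
  have cnt: "length (filter P (right_col U)) = length (filter (\<lambda>c. P (g c)) U)" for P
    by (simp add: right_col_def g_def[symmetric] length_filter_sort filter_map o_def)
  have "filter (\<lambda>c. g c \<le> Unb m) U = filter (\<lambda>c. c \<le> Unb m) U"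
    by (intro filter_cong) (auto simp: g_def split: letter.splits)
  then show "int (length (filter (\<lambda>x. x \<le> Unb m) (right_col U))) = unb_count U m"
    unfolding cnt unb_count_def by simp
  have le: "split_map U x \<le> m \<longleftrightarrow> x \<le> m \<or> (x \<in> doubles U \<and> split_map U x \<le> m \<and> m < x)" for x
    using sp(1,2)[of x] by (cases "x \<in> doubles U") auto
  have "{c \<in> set U. \<not> g c \<le> Bar (Suc m)} =
      {c \<in> set U. Bar m \<le> c} \<union> Bar ` {x \<in> doubles U. split_map U x \<le> m \<and> m < x}"
  proof (rule set_eqI)
    fix c
    show "c \<in> {c \<in> set U. \<not> g c \<le> Bar (Suc m)} \<longleftrightarrow>
        c \<in> {c \<in> set U. Bar m \<le> c} \<union> Bar ` {x \<in> doubles U. split_map U x \<le> m \<and> m < x}"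
      using le by (cases c) (auto simp: g_def doubles_def not_le less_Suc_eq_le simp flip: not_less)
  qed
  then have "int (length (filter (\<lambda>c. \<not> g c \<le> Bar (Suc m)) U)) = bar_count U m + pending U m"
    unfolding bar_count_def length_filter_distinct[OF d]
    by (subst pending_disjoint_union[symmetric, of Bar]) (auto simp: inj_def)
  then show "int (length (filter (\<lambda>x. x \<le> Bar (Suc m)) (right_col U))) =
      int (length U) - bar_count U m - pending U m"
    unfolding cnt using sum_length_filter_compl[of "\<lambda>c. g c \<le> Bar (Suc m)" U] by simp
  show "length (filter (\<lambda>x. x \<le> Bar 0) (right_col U)) = length U"
    unfolding cnt by (simp add: letter_le_Bar_0)
qed

lemma all_letters_iff: "(\<forall>a. P a) \<longleftrightarrow> (\<forall>m. P (Unb m)) \<and> (\<forall>m. P (Bar (Suc m))) \<and> P (Bar 0)"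
  by (metis letter.exhaust not0_implies_Suc)

lemma counts_above:
  assumes col: "is_column n U" and "n \<le> m"
  shows "unb_count U m = unb_count U n" "bar_count U m = bar_count U n" "pending U n = 0" "pending U m = 0"
proof -
  have le: "x \<le> Unb m \<longleftrightarrow> x \<le> Unb n" "Bar m \<le> x \<longleftrightarrow> Bar n \<le> x" if x: "x \<in> set U" for x
  proof -
    obtain j where "j \<le> n" "x = Unb j \<or> x = Bar j" using is_column_letter[OF col x] by metis
    then show "x \<le> Unb m \<longleftrightarrow> x \<le> Unb n" "Bar m \<le> x \<longleftrightarrow> Bar n \<le> x" using assms(2) by auto
  qed
  show "unb_count U m = unb_count U n" "bar_count U m = bar_count U n"
    unfolding unb_count_def bar_count_def using le by (metis (mono_tags, lifting) filter_cong)+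
  have "pending U k = 0" if "n \<le> k" for k
  proof -
    have "x \<notin> doubles U" if "k < x" for x
      using doubles_range[OF col, of x] that \<open>n \<le> k\<close> by linarith
    then have none: "{x \<in> doubles U. split_map U x \<le> k \<and> k < x} = {}" by blast
    show ?thesis unfolding pending_def none by simp
  qed
  then show "pending U n = 0" "pending U m = 0" using assms(2) by blast+
qed

lemma prec_iff_fits:
  assumes U: "admissible n U" and V: "admissible n V"
  shows "V \<preceq> U \<longleftrightarrow> fits n U V"
proof -
  have col: "is_column n U" "is_column n V" using assms by (auto simp: admissible_iff)
  have "pending V 0 = 0"
  proof -
    have none: "{x \<in> doubles V. split_map V x \<le> 0 \<and> 0 < x} = {}"
      using split_map_props(2)[OF V] by (force simp: holes_def)
    show ?thesis unfolding pending_def none by simp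
  qed
  \<comment> \<open>The height condition is the barred inequality at \<open>m = 0\<close>, where
    nothing is pending because targets are at least 1.\<close>
  then have len: "length U \<le> length V"
    if "\<forall>m. int (length U) - bar_count U m \<le> int (length V) - bar_count V m - pending V m"
    using that[rule_format, of 0] counts_0[OF col(1)] counts_0[OF col(2)] by simp
  have "V \<preceq> U \<longleftrightarrow>
      (\<forall>a. int (length (filter (\<lambda>x. x \<le> a) (left_col U))) \<le> int (length (filter (\<lambda>x. x \<le> a) (right_col V))))"
    unfolding col_prec_def
    by (subst col_le_iff_counts) (simp_all add: left_col_def right_col_def)
  also have "\<dots> \<longleftrightarrow> (\<forall>m. unb_count U m + pending U m \<le> unb_count V m) \<and>
      (\<forall>m. int (length U) - bar_count U m \<le> int (length V) - bar_count V m - pending V m)"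
    unfolding all_letters_iff left_col_counts[OF U] right_col_counts[OF V] using len by auto
  also have "\<dots> \<longleftrightarrow> (\<forall>m\<le>n. unb_count U m + pending U m \<le> unb_count V m \<and>
      int (length U) - bar_count U m \<le> int (length V) - bar_count V m - pending V m)"
    (is "_ \<longleftrightarrow> (\<forall>m\<le>n. ?P m)")
  proof -
    have "?P m \<longleftrightarrow> ?P n" if "n \<le> m" for m
      using counts_above[OF col(1) that] counts_above[OF col(2) that] by simp
    then show ?thesis by (meson nle_le)
  qed
  \<comment> \<open>Adding \<open>bar_count U m - m\<close> to the unbarred inequality and
    \<open>unb_count V m - m\<close> to the barred one gives both the same upper side.\<close>
  also have "\<dots> \<longleftrightarrow> (\<forall>m\<le>n. excess U m + pending U m \<le> mixed U V m \<and>
      excess V m + pending V m + (int (length U) - int (length V)) \<le> mixed U V m)"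
    by (auto simp: excess_def mixed_def abs_count_def)
  also have "\<dots> \<longleftrightarrow> fits n U V"
  proof
    assume "\<forall>m\<le>n. excess U m + pending U m \<le> mixed U V m \<and>
      excess V m + pending V m + (int (length U) - int (length V)) \<le> mixed U V m"
    then show "fits n U V"
      unfolding fits_def bounded_def
      using excess_le_pending[OF U] excess_le_pending[OF V] by (smt (verit, best) order_trans)
  next
    assume "fits n U V"
    then show "\<forall>m\<le>n. excess U m + pending U m \<le> mixed U V m \<and>
      excess V m + pending V m + (int (length U) - int (length V)) \<le> mixed U V m"
      unfolding fits_def bounded_def using pending_attained[OF U] pending_attained[OF V] by metis
  qed
  finally show ?thesis .
qed

section \<open>Highest weight vertices\<close>

definition top_column :: "nat \<Rightarrow> column" where
  "top_column p = map Unb [1..<Suc p]"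

lemma set_top_column: "set (top_column p) = Unb ` {1..p}"
  by (simp add: top_column_def atLeastLessThanSuc_atLeastAtMost del: upt_Suc)

lemma sorted_top_column: "sorted_wrt (<) (top_column p)"
  by (simp add: top_column_def sorted_wrt_map del: upt_Suc)

lemma length_top_column [simp]: "length (top_column p) = p"
  by (simp add: top_column_def)

lemma top_column_0 [simp]: "top_column 0 = []"
  by (simp add: top_column_def)

lemma highest_column:
  assumes v: "admissible n v" and p: "p = 0 \<or> Unb p \<in> set v"
    and hw: "\<And>i. 1 \<le> i \<Longrightarrow> i \<le> n \<Longrightarrow> no_minus n i (top_column p @ v)"
  shows "v = top_column (length v)"
proof -
  have col: "is_column n v" and adm: "\<And>m. m \<le> n \<Longrightarrow> abs_count v m \<le> int m"
    using v by (auto simp: admissible_iff)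
  have sv: "sorted_wrt (<) v" and dv: "distinct v"
    using col is_column_distinct by (auto simp: is_column_def)
  have d: "distinct (top_column p)" by (simp add: top_column_def distinct_map inj_on_def)
  have pn: "p \<le> n" using p col by (auto simp: is_column_def alphabet_def)
  have sum: "sign_sum n i (top_column p) = of_bool (i = p)" if "1 \<le> i" "i \<le> n" for i
  proof (cases "i < n")
    case True
    then show ?thesis using sign_sum_distinct(1)[OF d True] that by (auto simp: set_top_column of_bool_def)
  next
    case False
    then show ?thesis using sign_sum_distinct(2)[OF d, of n] that pn by (auto simp: set_top_column of_bool_def)
  qed
  \<comment> \<open>In \<open>1...p\<close> every sign cancels except a plus for
    \<open>i = p\<close>, the credit with which \<open>v\<close> starts.\<close>
  have hw': "nominus (sign_at n i) (of_bool (i = p)) v" if "1 \<le> i" "i \<le> n" for i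
    using hw[OF that] sum[OF that] by (simp add: nominus_append)
  have down: "Unb i \<in> set v" if "Unb (Suc i) \<in> set v" "1 \<le> i" for i
  proof -
    have "i < n" using that(1) col by (auto simp: is_column_def alphabet_def)
    then show ?thesis
      using nominus_column(1)[OF sv hw'[OF that(2)]] that p by (auto simp: of_bool_def split: if_splits)
  qed
  have below: "Unb i \<in> set v" if "Unb j \<in> set v" "1 \<le> i" "i \<le> j" for i j
    using that(3,1)
  proof (induction j rule: dec_induct)
    case (step m)
    then show ?case using down[of m] that(2) by simp
  qed
  have unb_count_full: "unb_count v m = int m" if "Unb j \<in> set v" "m \<le> j" for j m
    using that(2)
  proof (induction m)
    case (Suc m)
    then show ?case using unb_count_Suc[OF dv, of m] below[OF that(1), of "Suc m"] by simp
  qed (use counts_0[OF col] in simp)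
  have nobar: "Bar j \<notin> set v" for j
  proof
    assume "Bar j \<in> set v"
    define B where "B = {j. Bar j \<in> set v}"
    have sub: "B \<subseteq> {1..n}" using col by (auto simp: B_def is_column_def alphabet_def)
    then have fin: "finite B" using finite_subset by blast
    \<comment> \<open>For the largest barred index \<open>k\<close> the barred \<open>k+1\<close> is
      missing. Only \<open>k\<close> in \<open>v\<close>, or the credit if \<open>k = p\<close>, can
      absorb the barred \<open>k\<close>, and \<open>p\<close> lies in \<open>v\<close> anyway. So
      \<open>1, ..., k\<close> and the barred \<open>k\<close> all count in
      \<open>N(k)\<close>.\<close>
    define k where "k = Max B"
    have "k \<in> B" using Max_in[OF fin] \<open>Bar j \<in> set v\<close> by (auto simp: k_def B_def)
    moreover have "Suc k \<notin> B" using Max_ge[OF fin, of "Suc k"] by (auto simp: k_def)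
    ultimately have k: "Bar k \<in> set v" "Bar (Suc k) \<notin> set v" "1 \<le> k" "k \<le> n"
      using sub by (auto simp: B_def)
    have uk: "Unb k \<in> set v"
    proof (cases "k < n")
      case True
      then show ?thesis
        using nominus_column(2)[OF sv hw'[OF k(3,4)]] k p by (auto simp: of_bool_def split: if_splits)
    next
      case False
      then show ?thesis
        using nominus_column(3)[OF sv hw'[OF k(3,4)]] k p by (auto simp: of_bool_def split: if_splits)
    qed
    obtain l where l: "k = Suc l" using k(3) by (cases k) auto
    have "0 \<le> bar_count v l" by (simp add: bar_count_def)
    then have "bar_count v k \<ge> 1" using bar_count_Suc[OF dv, of l] k(1) l by simp
    then show False using unb_count_full[OF uk order_refl] adm[OF k(4)] by (simp add: abs_count_def)
  qed
  define q where "q = length v"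
  have "set v = Unb ` {1..q}"
  proof -
    define S where "S = {i. Unb i \<in> set v}"
    have Sv: "set v = Unb ` S" 
    proof (rule set_eqI)
      fix x show "x \<in> set v \<longleftrightarrow> x \<in> Unb ` S" using nobar by (cases x) (auto simp: S_def)
    qed
    have fin: "finite S" using finite_imageD[of Unb S] by (auto simp: Sv[symmetric] inj_on_def)
    have pos: "\<And>i. i \<in> S \<Longrightarrow> 1 \<le> i" using col by (auto simp: S_def is_column_def alphabet_def)
    have "S = {1..card S}"
    proof (cases "S = {}")
      case False
      define M where "M = Max S"
      have M: "M \<in> S" "\<And>i. i \<in> S \<Longrightarrow> i \<le> M"
        using Max_in[OF fin False] Max_ge[OF fin] by (auto simp: M_def)
      have "S = {1..M}"
      proof (intro equalityI subsetI)
        fix i assume "i \<in> {1..M}"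
        then have "Unb i \<in> set v" using below[of M i] M(1) by (simp add: S_def)
        then show "i \<in> S" by (simp add: S_def)
      qed (use pos M(2) in simp)
      then show ?thesis by simp
    qed simp
    moreover have "card S = q"
      using distinct_card[OF dv] card_image[of Unb S] by (simp add: Sv q_def inj_on_def)
    ultimately show ?thesis using Sv by simp
  qed
  then show ?thesis
    using sv sorted_top_column[of q] strict_sorted_equal[of v "top_column q"]
    by (simp add: q_def set_top_column)
qed

lemma unb_count_top: "unb_count (top_column p) m = int (min m p)"
  by (induction p) (auto simp: top_column_def unb_count_append unb_count_Cons)

lemma bar_count_top: "bar_count (top_column p) m = 0"
  by (induction p) (auto simp: top_column_def bar_count_append bar_count_Cons)

lemma fits_top:
  assumes "p \<le> q"
  shows "fits n (top_column p) (top_column q)"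
  unfolding fits_def bounded_def
proof (intro allI impI conjI; elim conjE)
  fix m k :: nat assume "m \<le> k"
  then show "excess (top_column p) k \<le> mixed (top_column p) (top_column q) m"
    "excess (top_column q) k + (int (length (top_column p)) - int (length (top_column q)))
      \<le> mixed (top_column p) (top_column q) m"
    using assms by (simp_all add: mixed_def excess_def abs_count_def unb_count_top bar_count_top min_def)
qed

section \<open>Passage along components\<close>

definition column_pair :: "nat \<Rightarrow> nat \<Rightarrow> nat \<Rightarrow> word \<Rightarrow> bool" where
  "column_pair n p q w \<longleftrightarrow> length w = p + q \<and> admissible n (take p w) \<and> admissible n (drop p w)"

text \<open>A step keeps the length, so the cut after \<open>p\<close> letters stays meaningful; the
  changed letter lies in one of the two factors, and the step restricts to it.\<close>

lemma arrow_column_pair: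
  assumes "arrow n i a b"
  shows "column_pair n p q a \<longleftrightarrow> column_pair n p q b"
    and "column_pair n p q a \<Longrightarrow> fits n (take p a) (drop p a) \<longleftrightarrow> fits n (take p b) (drop p b)"
proof -
  have i: "1 \<le> i" "i \<le> n" using assms by (auto simp: arrow_def)
  obtain xs x ys where ab: "a = xs @ x # ys" "b = xs @ f_letter n i x # ys" and st: "f_step n i xs x ys"
    using assms by (auto simp: arrow_def f_op_Some_iff)
  have "(column_pair n p q a \<longleftrightarrow> column_pair n p q b) \<and>
    (column_pair n p q a \<longrightarrow> (fits n (take p a) (drop p a) \<longleftrightarrow> fits n (take p b) (drop p b)))"
  proof (cases "length xs < p")
    case True
    then obtain r where r: "p = length xs + Suc r" using less_iff_Suc_add by auto
    define us where "us = take r ys"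
    define v where "v = drop r ys"
    have ys: "ys = us @ v" by (simp add: us_def v_def)
    have tk: "take p a = xs @ x # us" "drop p a = v"
      "take p b = xs @ f_letter n i x # us" "drop p b = v"
      by (simp_all add: ab r us_def v_def)
    have st': "f_step n i xs x us" using st by (simp add: f_step_def ys nominus_append)
    show ?thesis
      unfolding column_pair_def tk using admissible_f_step[OF st' i]
        fits_f_step_left[of n i xs x us v] st i by (auto simp: ab ys admissible_iff)
  next
    case False
    define u where "u = take p xs"
    define zs where "zs = drop p xs"
    have xs: "xs = u @ zs" by (simp add: u_def zs_def)
    have tk: "take p a = u" "drop p a = zs @ x # ys"
      "take p b = u" "drop p b = zs @ f_letter n i x # ys"
      using False by (simp_all add: ab u_def zs_def)
    have st': "f_step n i zs x ys" using st by (simp add: f_step_def xs noplus_append)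
    show ?thesis
      unfolding column_pair_def tk using admissible_f_step[OF st' i]
        fits_f_step_right[of n i u zs x ys] st i by (auto simp: ab xs admissible_iff)
  qed
  then show "column_pair n p q a \<longleftrightarrow> column_pair n p q b"
    "column_pair n p q a \<Longrightarrow> fits n (take p a) (drop p a) \<longleftrightarrow> fits n (take p b) (drop p b)"
    by auto
qed

lemma component_column_pair:
  assumes "b \<in> component n a" "column_pair n p q a"
  shows "column_pair n p q b \<and> (fits n (take p a) (drop p a) \<longleftrightarrow> fits n (take p b) (drop p b))"
proof -
  have "equivclp (\<lambda>a b. \<exists>i. arrow n i a b) a b" using assms(1) by (simp add: component_def)
  then show ?thesis
  proof (induction rule: equivclp_induct)
    case base
    then show ?case using assms(2) by simp
  next
    case (step y z)
    then show ?case using arrow_column_pair by blast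
  qed
qed

lemma component_words: "b \<in> component n a \<Longrightarrow> a \<in> words n \<Longrightarrow> b \<in> words n"
proof -
  assume b: "b \<in> component n a" and a: "a \<in> words n"
  have "equivclp (\<lambda>a b. \<exists>i. arrow n i a b) a b" using b by (simp add: component_def)
  then show ?thesis by (induction rule: equivclp_induct) (use a in \<open>auto simp: arrow_def\<close>)
qed

lemma component_arrow:
  assumes "b \<in> component n a" "arrow n i c b"
  shows "c \<in> component n a"
proof -
  have "equivclp (\<lambda>a b. \<exists>i. arrow n i a b) a b" using assms(1) by (simp add: component_def)
  then have "equivclp (\<lambda>a b. \<exists>i. arrow n i a b) a c"
    by (rule equivclp_into_equivclp) (use assms(2) in blast)
  then show ?thesis by (simp add: component_def)
qed

text \<open>Expressed by arrows, because these are what a crystal isomorphism transports.\<close>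

definition source :: "nat \<Rightarrow> word \<Rightarrow> bool" where
  "source n w \<longleftrightarrow> (\<forall>i a. \<not> arrow n i a w)"

lemma source_no_minus:
  assumes "source n w" "w \<in> words n" "1 \<le> i" "i \<le> n"
  shows "no_minus n i w"
proof (rule ccontr)
  assume "\<not> no_minus n i w"
  then obtain xs x ys where w: "w = xs @ f_letter n i x # ys" "f_step n i xs x ys"
    "f_op n i (xs @ x # ys) = Some w" using not_no_minus_f_op by blast
  have "x \<in> alphabet n"
    using w(2) assms(3,4) by (auto simp: f_step_def is_plus_def alphabet_def)
  then have "xs @ x # ys \<in> words n" using assms(2) by (auto simp: words_def w(1))
  then show False using assms w(3) by (auto simp: source_def arrow_def)
qed

text \<open>The rank of a letter in the ordered alphabet. Each arrow raises the sum of the ranks, so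
  a vertex of a component with minimal sum is a source.\<close>

fun letter_pos :: "nat \<Rightarrow> letter \<Rightarrow> nat" where
  "letter_pos n (Unb i) = i"
| "letter_pos n (Bar i) = 2 * n + 1 - i"

lemma arrow_letter_pos:
  assumes "arrow n i a b"
  shows "sum_list (map (letter_pos n) a) < sum_list (map (letter_pos n) b)"
proof -
  have i: "1 \<le> i" "i \<le> n" using assms by (auto simp: arrow_def)
  obtain xs x ys where ab: "a = xs @ x # ys" "b = xs @ f_letter n i x # ys" and st: "f_step n i xs x ys"
    using assms by (auto simp: arrow_def f_op_Some_iff)
  have "letter_pos n x < letter_pos n (f_letter n i x)"
    using st i(2) by (cases rule: f_step_cases) (use i in auto)
  then show ?thesis by (simp add: ab)
qed

lemma component_source: "\<exists>s\<in>component n w. source n s"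
proof -
  define f where "f = (\<lambda>w. sum_list (map (letter_pos n) w))"
  have "w \<in> component n w" by (simp add: component_def)
  then obtain s where s: "s \<in> component n w" "\<And>y. y \<in> component n w \<Longrightarrow> f s \<le> f y"
    using ex_has_least_nat[of "\<lambda>x. x \<in> component n w" w f] by blast
  then have "source n s"
    unfolding source_def using component_arrow arrow_letter_pos by (metis f_def not_le)
  then show ?thesis using s(1) by blast
qed

text \<open>Prefixes of a word without surviving minus have none either, so the first column falls
  under \<open>highest_column\<close> with empty prefix.\<close>

lemma source_pair:
  assumes "source n w" "w \<in> words n" "column_pair n p q w"
  shows "take p w = top_column p"
    and "p = 0 \<or> Unb p \<in> set (drop p w) \<Longrightarrow> drop p w = top_column q"
proof -
  define u where "u = take p w"
  define v where "v = drop p w"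
  have uv: "w = u @ v" "length u = p" "length v = q" "admissible n u" "admissible n v"
    using assms(3) by (auto simp: u_def v_def column_pair_def)
  have nm: "no_minus n i (u @ v)" if "1 \<le> i" "i \<le> n" for i
    using source_no_minus[OF assms(1,2) that] uv(1) by simp
  have "u = top_column (length u)"
    using highest_column[OF uv(4), of 0] nm by (simp add: nominus_append)
  then show u: "take p w = top_column p" using uv(2) by (simp add: u_def)
  show "drop p w = top_column q" if "p = 0 \<or> Unb p \<in> set (drop p w)"
    using highest_column[OF uv(5), of p] nm that uv(3) u unfolding u_def v_def by metis
qed

lemma wt_top: "1 \<le> i \<Longrightarrow> wt (top_column p) i = of_bool (i \<le> p)"
  by (induction p) (simp_all add: top_column_def wt_def)

lemma wt_append: "wt (u @ v) i = wt u i + wt v i"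
  by (simp add: wt_def)

theorem lemma3p3p8:
  fixes n :: nat and U V W :: column and T :: "column list"
  assumes "1 \<le> n"
    and "admissible n U" and "admissible n V"
    and "\<not> V \<preceq> U"
    and "is_P_tableau n (U @ V) T"
    and "length T = 2"
    and "W = last T"
  shows "length W < length U"
proof (rule ccontr)
  assume "\<not> length W < length U"
  then have le: "length U \<le> length W" by simp
  obtain W' where T: "T = [W', W]"
    using assms(6,7) by (auto simp: length_Suc_conv numeral_2_eq_2)
  have W: "admissible n W" "admissible n W'" "W' \<preceq> W"
    using assms(5) by (auto simp: is_P_tableau_def symplectic_tableau_def T)
  then have fW: "fits n W W'" by (simp add: prec_iff_fits)
  have "crystal_equiv n (U @ V) (W @ W')"
    using assms(5) by (auto simp: is_P_tableau_def tableau_reading_def T)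
  then obtain \<phi> where words: "U @ V \<in> words n" "W @ W' \<in> words n"
    and iso: "crystal_iso n (component n (U @ V)) (component n (W @ W')) \<phi>"
    by (auto simp: crystal_equiv_def)
  define p q k l where "p = length U" and "q = length V" and "k = length W" and "l = length W'"
  obtain s where s: "s \<in> component n (U @ V)" "source n s" using component_source by blast
  define t where "t = \<phi> s"
  have t: "t \<in> component n (W @ W')" "source n t"
  proof -
    have bij: "bij_betw \<phi> (component n (U @ V)) (component n (W @ W'))"
      and arr: "\<And>a b i. a \<in> component n (U @ V) \<Longrightarrow> b \<in> component n (U @ V) \<Longrightarrow>
        arrow n i a b \<longleftrightarrow> arrow n i (\<phi> a) (\<phi> b)"
      using iso by (auto simp: crystal_iso_def)
    show t: "t \<in> component n (W @ W')" using bij s(1) by (auto simp: t_def bij_betw_def)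
    \<comment> \<open>An arrow into \<open>t\<close> would start inside the component and pull back
      along \<open>\<phi>\<close> to an arrow into \<open>s\<close>.\<close>
    show "source n t"
      unfolding source_def
    proof (intro allI notI)
      fix i a assume a: "arrow n i a t"
      then have "a \<in> component n (W @ W')" using component_arrow t by blast
      then obtain a' where a': "a' \<in> component n (U @ V)" "a = \<phi> a'"
        using bij by (auto simp: bij_betw_def)
      then show False using arr[OF a'(1) s(1), of i] s(2) a by (simp add: source_def t_def)
    qed
  qed
  have wt: "wt s = wt t" using iso s(1) by (simp add: crystal_iso_def t_def)
  have ps: "column_pair n p q s" "fits n U V \<longleftrightarrow> fits n (take p s) (drop p s)"
    using component_column_pair[OF s(1), of p q] assms(2,3) by (auto simp: column_pair_def p_def q_def)
  have pt: "column_pair n k l t" "fits n (take k t) (drop k t)"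
    using component_column_pair[OF t(1), of k l] W fW by (auto simp: column_pair_def k_def l_def)
  note hs = source_pair[OF s(2) component_words[OF s(1) words(1)] ps(1)]
  note ht = source_pair[OF t(2) component_words[OF t(1) words(2)] pt(1)]
  have len: "length (drop k t) = l" "length (drop p s) = q"
    using pt(1) ps(1) by (auto simp: column_pair_def)
  have colt: "is_column n (drop k t)" "is_column n (take k t)" "is_column n (drop p s)"
    using pt(1) ps(1) by (auto simp: column_pair_def admissible_iff)
  have kn: "k \<le> n"
    using abs_count_eq_length[OF colt(2)] pt(1) len by (auto simp: column_pair_def admissible_iff)
  \<comment> \<open>The first family of inequalities on the diagonal, with both indices equal to
    \<open>m\<close>.\<close>
  have fb: "mixed (take k t) (drop k t) m \<ge> excess (take k t) m" if "m \<le> n" for m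
    using pt(2) that by (simp add: fits_def bounded_def)
  have "k = 0 \<or> Unb k \<in> set (drop k t)"
  proof -
    \<comment> \<open>The first column being \<open>1...k\<close>, the diagonal inequality says that
      the second has at least \<open>k\<close> letters up to \<open>k\<close>. At most
      \<open>k - 1\<close> of them are below \<open>k\<close>, so \<open>k\<close> occurs.\<close>
    have c: "unb_count (drop k t) m \<ge> int (min m k)" if "m \<le> n" for m
      using fb[OF that]
      by (simp add: ht(1) mixed_def excess_def abs_count_def unb_count_top bar_count_top)
    have upper: "unb_count (drop k t) m \<le> int m" for m
    proof (induction m)
      case (Suc m)
      then show ?case using unb_count_Suc[OF is_column_distinct[OF colt(1)], of m] by (auto simp: of_bool_def)
    qed (simp add: counts_0[OF colt(1)])
    show ?thesis
    proof (cases k)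
      case (Suc j)
      then show ?thesis
        using unb_count_Suc[OF is_column_distinct[OF colt(1)], of j] c[OF kn] upper[of j]
        by (auto simp: of_bool_def split: if_splits)
    qed simp
  qed
  then have dt: "drop k t = top_column l" by (rule ht(2))
  have "fits n (take k t) (drop k t)" by (rule pt(2))
  \<comment> \<open>At index 0 the second family reads \<open>k - l \<le> 0\<close>.\<close>
  then have kl: "k \<le> l"
    using len ht(1) dt unfolding fits_def bounded_def
    by (auto simp: mixed_def excess_def abs_count_def unb_count_top bar_count_top
      dest!: spec[of _ 0])
  have "p = 0 \<or> Unb p \<in> set (drop p s)"
  proof (cases "p = 0")
    case False
    have "wt s p = wt (take p s) p + wt (drop p s) p" "wt t p = wt (take k t) p + wt (drop k t) p"
      by (metis wt_append append_take_drop_id)+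
    moreover have "1 \<le> p" "p \<le> k" using False le by (simp_all add: p_def k_def Suc_le_eq)
    \<comment> \<open>Since \<open>p \<le> k \<le> l\<close>, the source \<open>t\<close> has weight
      2 at \<open>p\<close>; the prefix \<open>1...p\<close> of \<open>s\<close> accounts for only
      1.\<close>
    ultimately have "wt (drop p s) p = 1"
      using wt hs(1) ht(1) dt kl wt_top[of p] by simp
    then have "count_list (drop p s) (Unb p) \<noteq> 0" by (auto simp: wt_def)
    then show ?thesis by (simp add: count_list_0_iff)
  qed simp
  then have ds: "drop p s = top_column q" by (rule hs(2))
  have "p \<le> q"
    using \<open>p = 0 \<or> Unb p \<in> set (drop p s)\<close> by (auto simp: ds set_top_column)
  then have "fits n U V" using ps(2) hs(1) ds fits_top by simp
  then show False using assms(2-4) by (simp add: prec_iff_fits)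
qed

end
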